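(* Let $d\ge2$, let $c$ be a probability density on $[0,1]^d$, let $\gamma$ be an integrable non-negative function on $\Delta(0,\mathrm{id})$, and let $\varepsilon:\{0,1\}^d\times S_d\to[-1,1]$. Assume that for all $u\in\Delta(0,\mathrm{id})$ $$\gamma(u)\le\min_{(\alpha,\beta):\,\varepsilon(\alpha,\beta)>0}\frac{c(\tau_\alpha(\sigma_{\beta^{-1}}(u)))}{\varepsilon(\alpha,\beta)}.$$ Define on $[0,1]^d$ the function $$\theta_{\varepsilon,\gamma}(u)=c(u)-\sum_{\alpha\in\{0,1\}^d,\ \beta\in S_d}\varepsilon(\alpha,\beta)\,\gamma(\sigma_\beta(\tau_\alpha(u)))\,1_{\Delta(\alpha,\beta)}(u).$$ (D) $\theta_{\varepsilon,\gamma}$ is a probability density if and only if $\sum_{\alpha,\beta}\varepsilon(\alpha,\beta)=0$. Assume now that $\sum_{\alpha,\beta}\varepsilon(\alpha,\beta)=0$ and let $U$ and $V$ be random vectors with densities $c$ and $\theta_{\varepsilon,\gamma}$ respectively. (G) $g(V)$ and $g(U)$ have the same law for every (measurable) symmetric $g$ if and only if $$\forall\alpha\in\{0,1\}^d,\quad\sum_{\beta\in S_d}\varepsilon(\sigma_{\beta^{-1}}(\alpha),\beta)=0.$$ In particular, in this case, $V_1+\cdots+V_d$ and $U_1+\cdots+U_d$ have the same law. ($\mathfrak M$) Fix $k\in[d]$. If $$\forall j\in[d],\ \forall a\in\{0,1\}^{d-1},\ \forall b\in S_{d-1},\quad\sum_{\aleph=0,1}\varepsilon(\omega_k(a,\aleph),\chi_j(b,k))=0,$$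 then $(V_1,\ldots,V_{k-1},V_{k+1},\ldots,V_d)$ and $(U_1,\ldots,U_{k-1},U_{k+1},\ldots,U_d)$ have the same law. ($\mathfrak C$) Suppose $c$ is a copula density. If $$\forall j,k\in[d],\quad\sum_{a\in\{0,1\}^{d-1},\,b\in S_{d-1}}\varepsilon(\omega_k(a,0),\chi_j(b,k))=\sum_{a\in\{0,1\}^{d-1},\,b\in S_{d-1}}\varepsilon(\omega_k(a,1),\chi_j(b,k))=0,$$ then $\theta_{\varepsilon,\gamma}$ is a copula density.
   Context: $[d]=\{1,\ldots,d\}$ and $S_d$ is the set of permutations of $[d]$. For $\beta\in S_d$ and a $d$-tuple $u$, $\sigma_\beta(u)=(u_{\beta(1)},\ldots,u_{\beta(d)})$. A function $g$ on $[0,1]^d$ is symmetric if $g\circ\sigma_\beta=g$ for all $\beta\in S_d$. For $\alpha\in\{0,1\}^d$ and $u\in[0,1]^d$, $\tau_\alpha(u)=\big(\alpha_i(1-u_i)+(1-\alpha_i)u_i\big)_{i=1}^d$. $\Delta(0,\mathrm{id})=\{u\in[0,1]^d: u_1<u_2<\cdots<u_d<1/2\}$ and for $(\alpha,\beta)\in\{0,1\}^d\times S_d$, $\Delta(\alpha,\beta)=\{u\in[0,1]^d:\sigma_\beta(\tau_\alpha(u))\in\Delta(0,\mathrm{id})\}$; the term $\gamma(\sigma_\beta(\tau_\alpha(u)))1_{\Delta(\alpha,\beta)}(u)$ is $0$ when $u\notin\Delta(\alpha,\beta)$. For a $(d-1)$-tuple $v$, a scalar $r$ and $k\in[d]$,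 $\omega_k(v,r)=(v_1,\ldots,v_{k-1},r,v_k,\ldots,v_{d-1})$ ($r$ inserted in position $k$). For $b\in S_{d-1}$ and $j,k\in[d]$, $\beta=\chi_j(b,k)\in S_d$ is given by: $\beta(j)=k$; for $i\le j-1$, $\beta(i)=b(i)$ if $b(i)\le k-1$ and $\beta(i)=b(i)+1$ if $b(i)\ge k$; for $i\ge j+1$, $\beta(i)=b(i-1)$ if $b(i-1)\le k-1$ and $\beta(i)=b(i-1)+1$ if $b(i-1)\ge k$. A copula density is a probability density on $[0,1]^d$ all of whose one-dimensional marginals are uniform on $[0,1]$. A minimum over the empty set is $+\infty$. Densities are with respect to Lebesgue measure.
   Formalization: The "only if" directions of (D) and (G) are proved under the added assumption that γ is not almost everywhere zero on Δ(0,id); they fail otherwise (γ = 0 gives θ = c for every ε). All other claims are proved without this assumption. *)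

theory Defs
  imports "HOL-Probability.Probability" "HOL-Combinatorics.Permutations"
begin

(* A d-tuple is a function on nat that is undefined outside {1..d} (as in PiE),
   so that equality of tuples is equality of functions. *)

definition cube :: "nat \<Rightarrow> (nat \<Rightarrow> real) set" where
  "cube d = (\<Pi>\<^sub>E i\<in>{1..d}. {0..1})"

definition cube_lborel :: "nat \<Rightarrow> (nat \<Rightarrow> real) measure" where
  "cube_lborel d = restrict_space (\<Pi>\<^sub>M i\<in>{1..d}. lborel) (cube d)"

definition bits :: "nat \<Rightarrow> (nat \<Rightarrow> nat) set" where
  "bits d = (\<Pi>\<^sub>E i\<in>{1..d}. {0, 1})"

definition perms :: "nat \<Rightarrow> (nat \<Rightarrow> nat) set" where
  "perms d = {\<beta>. \<beta> permutes {1..d}}"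

definition sigma_act :: "nat \<Rightarrow> (nat \<Rightarrow> nat) \<Rightarrow> (nat \<Rightarrow> 'a) \<Rightarrow> (nat \<Rightarrow> 'a)" where
  "sigma_act d \<beta> u = (\<lambda>i\<in>{1..d}. u (\<beta> i))"

definition tau_act :: "nat \<Rightarrow> (nat \<Rightarrow> nat) \<Rightarrow> (nat \<Rightarrow> real) \<Rightarrow> (nat \<Rightarrow> real)" where
  "tau_act d \<alpha> u = (\<lambda>i\<in>{1..d}. real (\<alpha> i) * (1 - u i) + (1 - real (\<alpha> i)) * u i)"

definition Delta0 :: "nat \<Rightarrow> (nat \<Rightarrow> real) set" where
  "Delta0 d = {u \<in> cube d. (\<forall>i\<in>{1..<d}. u i < u (i + 1)) \<and> u d < 1 / 2}"

definition Delta :: "nat \<Rightarrow> (nat \<Rightarrow> nat) \<Rightarrow> (nat \<Rightarrow> nat) \<Rightarrow> (nat \<Rightarrow> real) set" where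
  "Delta d \<alpha> \<beta> = {u \<in> cube d. sigma_act d \<beta> (tau_act d \<alpha> u) \<in> Delta0 d}"

definition symmetric_fun :: "nat \<Rightarrow> ((nat \<Rightarrow> real) \<Rightarrow> 'a) \<Rightarrow> bool" where
  "symmetric_fun d g \<longleftrightarrow> (\<forall>\<beta>\<in>perms d. \<forall>u\<in>cube d. g (sigma_act d \<beta> u) = g u)"

definition insert_coord :: "nat \<Rightarrow> nat \<Rightarrow> (nat \<Rightarrow> 'a) \<Rightarrow> 'a \<Rightarrow> (nat \<Rightarrow> 'a)" where
  "insert_coord d k v r =
     (\<lambda>i\<in>{1..d}. if i < k then v i else if i = k then r else v (i - 1))"

definition delete_coord :: "nat \<Rightarrow> nat \<Rightarrow> (nat \<Rightarrow> 'a) \<Rightarrow> (nat \<Rightarrow> 'a)" where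
  "delete_coord d k u = (\<lambda>i\<in>{1..d - 1}. if i < k then u i else u (i + 1))"

(* The permutation of {1..d} sending j to k and induced by b elsewhere;
   being the identity outside {1..d} is what makes it satisfy 'permutes'. *)
definition chi :: "nat \<Rightarrow> nat \<Rightarrow> (nat \<Rightarrow> nat) \<Rightarrow> nat \<Rightarrow> (nat \<Rightarrow> nat)" where
  "chi d j b k i =
     (if i \<notin> {1..d} then i
      else if i = j then k
      else if i < j then (if b i \<le> k - 1 then b i else b i + 1)
      else (if b (i - 1) \<le> k - 1 then b (i - 1) else b (i - 1) + 1))"

definition prob_density :: "nat \<Rightarrow> ((nat \<Rightarrow> real) \<Rightarrow> real) \<Rightarrow> bool" where
  "prob_density d f \<longleftrightarrow>
     f \<in> borel_measurable (cube_lborel d) \<and> (\<forall>u\<in>cube d. 0 \<le> f u) \<and>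
     (\<integral>\<^sup>+u. ennreal (f u) \<partial>cube_lborel d) = 1"

definition copula_density :: "nat \<Rightarrow> ((nat \<Rightarrow> real) \<Rightarrow> real) \<Rightarrow> bool" where
  "copula_density d f \<longleftrightarrow>
     prob_density d f \<and>
     (\<forall>i\<in>{1..d}. distr (density (cube_lborel d) (\<lambda>u. ennreal (f u))) lborel (\<lambda>u. u i)
        = uniform_measure lborel {0..1})"

definition theta ::
  "nat \<Rightarrow> ((nat \<Rightarrow> real) \<Rightarrow> real) \<Rightarrow> ((nat \<Rightarrow> nat) \<times> (nat \<Rightarrow> nat) \<Rightarrow> real) \<Rightarrow>
   ((nat \<Rightarrow> real) \<Rightarrow> real) \<Rightarrow> (nat \<Rightarrow> real) \<Rightarrow> real" where
  "theta d c \<epsilon> \<gamma> u =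
     c u - (\<Sum>(\<alpha>, \<beta>)\<in>bits d \<times> perms d.
              \<epsilon> (\<alpha>, \<beta>) * \<gamma> (sigma_act d \<beta> (tau_act d \<alpha> u)) * indicator (Delta d \<alpha> \<beta>) u)"

end

(* All maps u |-> sigma_beta(tau_alpha(u)) preserve Lebesgue measure on the cube and the cells
   Delta(alpha, beta) are disjoint, so for every measurable A
     int_A theta = int_A c - sum eps(alpha, beta) int_{Delta0} gamma(w) 1_A(tau_alpha(sigma_{beta^-1} w)) dw.
   Each claim then amounts to the vanishing of this finite sum for the sets A it involves. One groups
   the pairs (alpha, beta) according to what tau_alpha(sigma_{beta^-1} w) looks like on A:
   sigma_beta(alpha) for symmetric events, (alpha without its k-th entry, beta) for events that
   ignore coordinate k, and (alpha_k, beta^-1(k)) for events that only see coordinate k. *)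
theory Submission
  imports Defs
begin

subsection \<open>The two group actions on the cube\<close>

text \<open>Disjointness of the cells acts in two places. At a given point at most one summand of
  \<open>theta\<close> survives, so the bound on \<gamma> can be compared with the single value of
  \<open>c\<close> at that point; this gives nonnegativity. In the converse of (G) it lets one
  symmetric event isolate one bit vector \<alpha>. Both converse directions cancel the integral of
  \<gamma> over \<open>Delta0 d\<close>. If that integral is 0, then \<open>theta\<close> equals
  \<open>c\<close> almost everywhere and the left-hand sides hold whatever \<epsilon> is, so the two
  equivalences carry the premise that \<gamma> is not almost everywhere zero on the simplex.
  Permutations act on tuples by precomposition, that is, from the right. This is the origin of the
  inverses in \<open>sigma_act d (inv \<beta>)\<close> and of
  \<open>sigma_act d \<beta> \<alpha>\<close> as the right label of a symmetric orbit.\<close>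

lemma finite_bits [simp]: "finite (bits d)"
  unfolding bits_def by (intro finite_PiE) auto

lemma finite_perms [simp]: "finite (perms d)"
  unfolding perms_def by (rule finite_permutations) simp

lemma bits_iff: "\<alpha> \<in> bits d \<Longrightarrow> i \<in> {1..d} \<Longrightarrow> \<alpha> i = 0 \<or> \<alpha> i = 1"
  unfolding bits_def by auto

lemma perms_inv: "\<beta> \<in> perms d \<Longrightarrow> inv \<beta> \<in> perms d"
  unfolding perms_def by (simp add: permutes_inv)

lemma perms_in: "\<beta> \<in> perms d \<Longrightarrow> \<beta> i \<in> {1..d} \<longleftrightarrow> i \<in> {1..d}"
  unfolding perms_def by (auto simp only: permutes_in_image mem_Collect_eq)

lemma perms_inverses:
  assumes "\<beta> \<in> perms d"
  shows "\<beta> (inv \<beta> i) = i" "inv \<beta> (\<beta> i) = i"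
  using assms unfolding perms_def by (auto simp: permutes_inverses)

lemma tau_act_apply:
  "\<alpha> \<in> bits d \<Longrightarrow> i \<in> {1..d} \<Longrightarrow> tau_act d \<alpha> u i = (if \<alpha> i = 1 then 1 - u i else u i)"
  using bits_iff[of \<alpha> d i] by (auto simp: tau_act_def)

lemma tau_act_cube: "\<alpha> \<in> bits d \<Longrightarrow> u \<in> cube d \<Longrightarrow> tau_act d \<alpha> u \<in> cube d"
  unfolding cube_def
  by (auto simp: PiE_iff tau_act_apply) (auto simp: tau_act_def)

lemma sigma_act_cube: "\<beta> \<in> perms d \<Longrightarrow> u \<in> cube d \<Longrightarrow> sigma_act d \<beta> u \<in> cube d"
  unfolding cube_def using perms_in[of \<beta> d]
  by (auto simp: PiE_iff sigma_act_def)

lemma sigma_act_bits: "\<beta> \<in> perms d \<Longrightarrow> \<alpha> \<in> bits d \<Longrightarrow> sigma_act d \<beta> \<alpha> \<in> bits d"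
  unfolding bits_def using perms_in[of \<beta> d]
  by (auto simp: PiE_iff sigma_act_def)

lemma cube_eqI: "u \<in> cube d \<Longrightarrow> v \<in> cube d \<Longrightarrow> (\<And>i. i \<in> {1..d} \<Longrightarrow> u i = v i) \<Longrightarrow> u = v"
  unfolding cube_def by (rule PiE_ext)

lemma tau_act_tau_act:
  "\<alpha> \<in> bits d \<Longrightarrow> u \<in> cube d \<Longrightarrow> tau_act d \<alpha> (tau_act d \<alpha> u) = u"
  by (rule cube_eqI[of _ d]) (auto simp: tau_act_cube tau_act_apply)

text \<open>Extensionality makes these equalities of functions on all of \<open>nat\<close>: outside
  \<open>{1..d}\<close> the action returns \<open>undefined\<close>, and so must u.\<close>

lemma sigma_act_inv:
  assumes "\<beta> \<in> perms d" "u \<in> extensional {1..d}"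
  shows "sigma_act d \<beta> (sigma_act d (inv \<beta>) u) = u"
    and "sigma_act d (inv \<beta>) (sigma_act d \<beta> u) = u"
  using assms perms_in[of \<beta> d] perms_in[OF perms_inv[of \<beta> d]]
  by (auto simp: sigma_act_def perms_inverses extensional_def fun_eq_iff)

lemma cube_extensional: "u \<in> cube d \<Longrightarrow> u \<in> extensional {1..d}"
  unfolding cube_def by (simp add: PiE_def)

lemma bits_extensional: "\<alpha> \<in> bits d \<Longrightarrow> \<alpha> \<in> extensional {1..d}"
  unfolding bits_def by (simp add: PiE_def)

text \<open>The order of composition is reversed because the action precomposes a tuple with the
  permutation.\<close>

lemma sigma_act_comp:
  assumes "\<beta>' \<in> perms d"
  shows "sigma_act d \<beta>' (sigma_act d \<beta> u) = sigma_act d (\<beta> \<circ> \<beta>') u"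
proof
  fix i
  show "sigma_act d \<beta>' (sigma_act d \<beta> u) i = sigma_act d (\<beta> \<circ> \<beta>') u i"
    by (simp only: sigma_act_def restrict_apply perms_in[OF assms] comp_apply if_True cong: if_cong)
qed

lemma perms_comp: "\<beta> \<in> perms d \<Longrightarrow> \<beta>' \<in> perms d \<Longrightarrow> \<beta> \<circ> \<beta>' \<in> perms d"
  unfolding perms_def by (simp add: permutes_compose)

text \<open>The two maps are undone in reverse order, and a flip is its own inverse. This identifies
  the argument of \<open>c\<close> in the bound on \<gamma> with the point at which
  \<open>theta\<close> is evaluated.\<close>

lemma tau_sigma_left_inverse:
  assumes "\<alpha> \<in> bits d" "\<beta> \<in> perms d" "u \<in> cube d"
  shows "tau_act d \<alpha> (sigma_act d (inv \<beta>) (sigma_act d \<beta> (tau_act d \<alpha> u))) = u"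
  using sigma_act_inv(2)[OF assms(2) cube_extensional[OF tau_act_cube[OF assms(1,3)]]] assms
  by (simp add: tau_act_tau_act)

text \<open>Entry i of both sides is \<open>w (inv \<beta> i)\<close>, flipped according to
  \<open>\<alpha> i\<close>; on the right this bit is read from
  \<open>sigma_act d \<beta> \<alpha>\<close> at position \<open>inv \<beta> i\<close>. With the
  permutation outermost, a symmetric function sees only
  \<open>sigma_act d \<beta> \<alpha>\<close>.\<close>

lemma tau_sigma_commute:
  assumes "\<alpha> \<in> bits d" "\<beta> \<in> perms d" "w \<in> cube d"
  shows "tau_act d \<alpha> (sigma_act d (inv \<beta>) w) = sigma_act d (inv \<beta>) (tau_act d (sigma_act d \<beta> \<alpha>) w)"
  using assms perms_in[OF perms_inv[of \<beta> d]]
  by (auto simp: fun_eq_iff tau_act_def sigma_act_def perms_inverses)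

subsection \<open>Measure preservation\<close>

lemma space_cube_lborel [simp]: "space (cube_lborel d) = cube d"
  unfolding cube_lborel_def by (auto simp: space_restrict_space space_PiM cube_def PiE_def)

lemma cube_in_sets: "cube d \<in> sets (\<Pi>\<^sub>M i\<in>{1..d}. lborel)"
  unfolding cube_def by (rule sets_PiM_I_finite) auto

lemma measurable_cube_lborelI:
  assumes "\<And>x. x \<in> space M \<Longrightarrow> f x \<in> cube d"
    and "\<And>i. i \<in> {1..d} \<Longrightarrow> (\<lambda>x. f x i) \<in> borel_measurable M"
  shows "f \<in> measurable M (cube_lborel d)"
  unfolding cube_lborel_def
proof (rule measurable_restrict_space2)
  show "f \<in> space M \<rightarrow> cube d" using assms(1) by auto
  show "f \<in> measurable M (\<Pi>\<^sub>M i\<in>{1..d}. lborel)"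
  proof (rule measurable_PiM_single')
    show "f \<in> space M \<rightarrow> {1..d} \<rightarrow>\<^sub>E space lborel"
      using assms(1) cube_extensional by (auto simp: PiE_def)
  qed (use assms(2) in auto)
qed

lemma measurable_cube_component [measurable]:
  "i \<in> {1..d} \<Longrightarrow> (\<lambda>u. u i) \<in> borel_measurable (cube_lborel d)"
  unfolding cube_lborel_def
  by (rule measurable_restrict_space1) (metis measurable_component_singleton measurable_lborel1)

lemma tau_act_measurable:
  assumes "\<alpha> \<in> bits d"
  shows "tau_act d \<alpha> \<in> measurable (cube_lborel d) (cube_lborel d)"
proof (rule measurable_cube_lborelI)
  fix i assume "i \<in> {1..d}"
  then show "(\<lambda>u. tau_act d \<alpha> u i) \<in> borel_measurable (cube_lborel d)"
    using assms measurable_cube_component[of i d] by (simp add: tau_act_apply)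
qed (use assms tau_act_cube in auto)

lemma sigma_act_measurable:
  assumes "\<beta> \<in> perms d"
  shows "sigma_act d \<beta> \<in> measurable (cube_lborel d) (cube_lborel d)"
proof (rule measurable_cube_lborelI)
  fix i assume "i \<in> {1..d}"
  then show "(\<lambda>u. sigma_act d \<beta> u i) \<in> borel_measurable (cube_lborel d)"
    using assms perms_in[of \<beta> d i] measurable_cube_component[of "\<beta> i" d] by (simp add: sigma_act_def)
qed (use assms sigma_act_cube in auto)

lemma Delta0_in_sets: "Delta0 d \<in> sets (cube_lborel d)" if "d \<ge> 1"
proof -
  have "Delta0 d = {u \<in> space (cube_lborel d). (\<forall>i\<in>{1..<d}. u i < u (i + 1)) \<and> u d < 1 / 2}"
    by (simp add: Delta0_def)
  also have "\<dots> \<in> sets (cube_lborel d)"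
    using that by (intro sets.sets_Collect_conj sets.sets_Collect_finite_All borel_measurable_less
        measurable_cube_component borel_measurable_const) auto
  finally show ?thesis .
qed

section \<open>Lebesgue measure on the cube as a product of unit intervals\<close>

abbreviation unit_lborel :: "real measure" where
  "unit_lborel \<equiv> restrict_space lborel {0..1}"

lemma emeasure_unit_lborel_flip:
  assumes "A \<in> sets unit_lborel"
  shows "emeasure unit_lborel ((\<lambda>x. 1 - x) -` A \<inter> {0..1}) = emeasure unit_lborel A"
proof -
  have A: "A \<in> sets borel" "A \<subseteq> {0..1}"
    using assms by (auto simp: sets_restrict_space)
  \<comment> \<open>The reflection is the affine map with slope -1 and offset 1; its Jacobian factor
    is the absolute value of the slope, hence 1.\<close>
  have "lborel = distr lborel borel (\<lambda>x::real. 1 + (-1) * x)"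
    using lborel_real_affine[of "-1" 1] by (simp add: density_1)
  then have "emeasure lborel A = emeasure (distr lborel borel (\<lambda>x::real. 1 + (-1) * x)) A"
    by simp
  also have "\<dots> = emeasure lborel ((\<lambda>x. 1 - x) -` A \<inter> {0..1})"
    using A by (subst emeasure_distr) (auto intro!: arg_cong[where f="emeasure lborel"])
  finally show ?thesis
    using A by (simp add: emeasure_restrict_space)
qed

lemma prob_space_unit_lborel: "prob_space unit_lborel"
  by (rule prob_spaceI) (simp add: emeasure_restrict_space space_restrict_space)

text \<open>A finite product of sigma-finite measures is determined by its values on boxes, and
  there both constructions give the product of the side lengths. The product form allows a
  coordinatewise map to be treated one factor at a time.\<close>

lemma cube_lborel_eq_PiM: "cube_lborel d = (\<Pi>\<^sub>M i\<in>{1..d}. unit_lborel)"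
proof -
  interpret product_sigma_finite "\<lambda>_::nat. unit_lborel"
    by (intro product_sigma_finite.intro prob_space_imp_sigma_finite prob_space_unit_lborel)
  \<comment> \<open>The two sigma-algebras are compared through the identity map, measurable in both
    directions.\<close>
  have id1: "id \<in> measurable (\<Pi>\<^sub>M i\<in>{1..d}. unit_lborel) (cube_lborel d)"
  proof (rule measurable_cube_lborelI)
    fix i assume "i \<in> {1..d}"
    then have "(\<lambda>x. x i) \<in> measurable (\<Pi>\<^sub>M i\<in>{1..d}. unit_lborel) unit_lborel"
      by (rule measurable_component_singleton)
    then show "(\<lambda>x. id x i) \<in> borel_measurable (\<Pi>\<^sub>M i\<in>{1..d}. unit_lborel)"
      by (simp add: measurable_restrict_space2_iff)
  qed (auto simp: space_PiM cube_def space_restrict_space)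
  have id2: "id \<in> measurable (cube_lborel d) (\<Pi>\<^sub>M i\<in>{1..d}. unit_lborel)"
  proof (rule measurable_PiM_single')
    show "id \<in> space (cube_lborel d) \<rightarrow> {1..d} \<rightarrow>\<^sub>E space unit_lborel"
      by (auto simp: cube_def space_restrict_space)
    fix i assume i: "i \<in> {1..d}"
    then show "(\<lambda>u. id u i) \<in> measurable (cube_lborel d) unit_lborel"
      using measurable_cube_component[OF i]
      by (intro measurable_restrict_space2) (auto simp: cube_def)
  qed
  have sp: "space (\<Pi>\<^sub>M i\<in>{1..d}. unit_lborel) = cube d"
    by (simp add: space_PiM cube_def space_restrict_space)
  have sets: "sets (cube_lborel d) = sets (\<Pi>\<^sub>M i\<in>{1..d}. unit_lborel)"
  proof (intro set_eqI iffI)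
    fix A assume A: "A \<in> sets (cube_lborel d)"
    have "A \<inter> cube d = A" using sets.Int_space_eq2[OF A] by (simp only: space_cube_lborel)
    then show "A \<in> sets (\<Pi>\<^sub>M i\<in>{1..d}. unit_lborel)"
      using measurable_sets[OF id1 A] by (simp only: sp vimage_id id_apply)
  next
    fix A assume A: "A \<in> sets (\<Pi>\<^sub>M i\<in>{1..d}. unit_lborel)"
    have "A \<inter> cube d = A" using sets.Int_space_eq2[OF A] by (simp only: sp)
    then show "A \<in> sets (cube_lborel d)"
      using measurable_sets[OF id2 A] by (simp only: space_cube_lborel vimage_id id_apply)
  qed
  show ?thesis
  proof (rule PiM_eqI)
    fix A :: "nat \<Rightarrow> real set" assume A: "\<And>i. i \<in> {1..d} \<Longrightarrow> A i \<in> sets unit_lborel"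
    interpret L: product_sigma_finite "\<lambda>_::nat. lborel :: real measure"
      by (intro product_sigma_finite.intro) (rule sigma_finite_lborel)
    have A': "A i \<in> sets borel" "A i \<subseteq> {0..1}" if "i \<in> {1..d}" for i
      using A[OF that] by (auto simp: sets_restrict_space)
    have "Pi\<^sub>E {1..d} A \<subseteq> cube d"
      using A'(2) unfolding cube_def by (intro PiE_mono) auto
    then have "emeasure (cube_lborel d) (Pi\<^sub>E {1..d} A) = emeasure (\<Pi>\<^sub>M i\<in>{1..d}. lborel) (Pi\<^sub>E {1..d} A)"
      using cube_in_sets unfolding cube_lborel_def by (subst emeasure_restrict_space) auto
    also have "\<dots> = (\<Prod>i\<in>{1..d}. emeasure lborel (A i))"
      using A' by (subst L.emeasure_PiM) auto
    also have "\<dots> = (\<Prod>i\<in>{1..d}. emeasure unit_lborel (A i))"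
      using A' by (intro prod.cong) (auto simp: emeasure_restrict_space)
    finally show "emeasure (cube_lborel d) (Pi\<^sub>E {1..d} A) = \<dots>" .
  qed (use sets in auto)
qed

section \<open>Invariance of the cube measure under flips and permutations\<close>

lemma sigma_tau_measurable:
  assumes "\<alpha> \<in> bits d" "\<beta> \<in> perms d"
  shows "(\<lambda>u. sigma_act d \<beta> (tau_act d \<alpha> u)) \<in> measurable (cube_lborel d) (cube_lborel d)"
  by (rule measurable_compose[OF tau_act_measurable sigma_act_measurable]) fact+

lemma tau_sigma_inv_measurable:
  assumes "\<alpha> \<in> bits d" "\<beta> \<in> perms d"
  shows "(\<lambda>u. tau_act d \<alpha> (sigma_act d (inv \<beta>) u)) \<in> measurable (cube_lborel d) (cube_lborel d)"
  by (rule measurable_compose[OF sigma_act_measurable tau_act_measurable]) (use assms perms_inv in auto)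

text \<open>The preimage of a box is again a box whose sides are permuted and possibly reflected.
  Reflection keeps the length of a side, and the product of the lengths does not depend on their
  order.\<close>

lemma distr_sigma_tau:
  assumes \<alpha>: "\<alpha> \<in> bits d" and \<beta>: "\<beta> \<in> perms d"
  shows "distr (cube_lborel d) (cube_lborel d) (\<lambda>u. sigma_act d \<beta> (tau_act d \<alpha> u)) = cube_lborel d"
    (is "distr ?M ?M ?\<Phi> = ?M")
proof -
  interpret product_sigma_finite "\<lambda>_::nat. unit_lborel"
    by (intro product_sigma_finite.intro prob_space_imp_sigma_finite prob_space_unit_lborel)
  note perm = perms_in[OF \<beta>] perms_in[OF perms_inv[OF \<beta>]]
  have "distr ?M ?M ?\<Phi> = (\<Pi>\<^sub>M i\<in>{1..d}. unit_lborel)"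
  proof (rule PiM_eqI)
    show "sets (distr ?M ?M ?\<Phi>) = sets (\<Pi>\<^sub>M i\<in>{1..d}. unit_lborel)"
      by (simp add: cube_lborel_eq_PiM)
    fix A :: "nat \<Rightarrow> real set" assume A: "\<And>i. i \<in> {1..d} \<Longrightarrow> A i \<in> sets unit_lborel"
    \<comment> \<open>Coordinate i of u lands at position \<open>inv \<beta> i\<close> of the image,
      which is the side it has to meet.\<close>
    define B where "B i = (if \<alpha> i = 1 then (\<lambda>x. 1 - x) -` A (inv \<beta> i) \<inter> {0..1} else A (inv \<beta> i))" for i
    have A': "A (inv \<beta> i) \<in> sets unit_lborel" "A (inv \<beta> i) \<subseteq> {0..1}" if "i \<in> {1..d}" for i
      using A[of "inv \<beta> i"] that perm sets.sets_into_space[of "A (inv \<beta> i)" unit_lborel]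
      by (auto simp: space_restrict_space)
    have B: "B i \<in> sets unit_lborel" if "i \<in> {1..d}" for i
    proof -
      have "(\<lambda>x. 1 - x) \<in> measurable unit_lborel unit_lborel"
        by (intro measurable_restrict_space2 measurable_restrict_space1)
           (auto simp: space_restrict_space)
      from measurable_sets[OF this A'(1)[OF that]] show ?thesis
        using A'(1)[OF that] by (auto simp: B_def space_restrict_space)
    qed
    have "?\<Phi> -` Pi\<^sub>E {1..d} A \<inter> cube d = Pi\<^sub>E {1..d} B"
    proof (intro set_eqI iffI)
      fix u assume u: "u \<in> ?\<Phi> -` Pi\<^sub>E {1..d} A \<inter> cube d"
      show "u \<in> Pi\<^sub>E {1..d} B"
      proof (rule PiE_I)
        fix i assume i: "i \<in> {1..d}"
        then have "?\<Phi> u (inv \<beta> i) \<in> A (inv \<beta> i)"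
          using u perm(2)[of i] by (auto simp: PiE_iff)
        then show "u i \<in> B i"
          using i \<alpha> \<beta> u perm(2)[of i]
          by (auto simp: sigma_act_def perms_inverses tau_act_apply B_def cube_def)
      qed (use u in \<open>auto simp: cube_def\<close>)
    next
      fix u assume u: "u \<in> Pi\<^sub>E {1..d} B"
      have "u \<in> cube d"
        using A'(2) unfolding cube_def
        by (intro subsetD[OF PiE_mono u]) (auto simp: B_def)
      moreover have "?\<Phi> u \<in> Pi\<^sub>E {1..d} A"
      proof (rule PiE_I)
        fix i assume i: "i \<in> {1..d}"
        then have "u (\<beta> i) \<in> B (\<beta> i)" using u perm(1)[of i] by (auto simp: PiE_iff)
        then show "?\<Phi> u i \<in> A i"
          using i \<alpha> \<beta> perm(1)[of i]
          by (auto simp: sigma_act_def perms_inverses tau_act_apply B_def split: if_splits)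
      qed (auto simp: sigma_act_def)
      ultimately show "u \<in> ?\<Phi> -` Pi\<^sub>E {1..d} A \<inter> cube d" by auto
    qed
    moreover have "Pi\<^sub>E {1..d} A \<in> sets ?M"
      unfolding cube_lborel_eq_PiM using A by (intro sets_PiM_I_finite) auto
    ultimately have "emeasure (distr ?M ?M ?\<Phi>) (Pi\<^sub>E {1..d} A) = emeasure ?M (Pi\<^sub>E {1..d} B)"
      using sigma_tau_measurable[OF \<alpha> \<beta>] by (subst emeasure_distr) auto
    also have "\<dots> = (\<Prod>i\<in>{1..d}. emeasure unit_lborel (B i))"
      unfolding cube_lborel_eq_PiM using B by (subst emeasure_PiM) auto
    also have "\<dots> = (\<Prod>i\<in>{1..d}. emeasure unit_lborel (A (inv \<beta> i)))"
      using A' emeasure_unit_lborel_flip by (intro prod.cong) (auto simp: B_def)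
    also have "\<dots> = (\<Prod>i\<in>{1..d}. emeasure unit_lborel (A i))"
      by (rule prod.reindex_bij_witness[of _ \<beta> "inv \<beta>"])
         (use perm \<beta> in \<open>auto simp only: perms_inverses\<close>)
    finally show "emeasure (distr ?M ?M ?\<Phi>) (Pi\<^sub>E {1..d} A) = \<dots>" .
  qed simp
  then show ?thesis by (simp add: cube_lborel_eq_PiM)
qed

subsection \<open>Removing one coordinate\<close>

lemma insert_coord_bits:
  assumes "a \<in> bits (d - 1)" "r \<in> {0, 1}" "k \<in> {1..d}"
  shows "insert_coord d k a r \<in> bits d"
  unfolding bits_def
proof (rule PiE_I)
  fix i assume i: "i \<in> {1..d}"
  then consider "i < k" "i \<in> {1..d - 1}" | "i = k" | "\<not> i < k" "i \<noteq> k" "i - 1 \<in> {1..d - 1}"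
    using assms(3) by fastforce
  then show "insert_coord d k a r i \<in> {0, 1}"
    using i assms(2) bits_iff[OF assms(1)] by cases (simp_all add: insert_coord_def)
qed (auto simp: insert_coord_def)

lemma delete_coord_bits:
  assumes "\<alpha> \<in> bits d"
  shows "delete_coord d k \<alpha> \<in> bits (d - 1)"
  unfolding bits_def
proof (rule PiE_I)
  fix i assume "i \<in> {1..d - 1}"
  then show "delete_coord d k \<alpha> i \<in> {0, 1}"
    using bits_iff[OF assms, of i] bits_iff[OF assms, of "i + 1"]
    by (auto simp: delete_coord_def)
qed (auto simp: delete_coord_def)

lemma insert_delete_coord:
  assumes "v \<in> extensional {1..d}" "k \<in> {1..d}"
  shows "insert_coord d k (delete_coord d k v) (v k) = v"
  using assms by (auto simp: insert_coord_def delete_coord_def extensional_def fun_eq_iff)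

lemma delete_insert_coord:
  assumes "v \<in> extensional {1..d - 1}" "k \<in> {1..d}"
  shows "delete_coord d k (insert_coord d k v r) = v"
  using assms by (auto simp: insert_coord_def delete_coord_def extensional_def fun_eq_iff)

text \<open>Insertion at position k is a bijection, inverted by reading off the k-th entry and
  deleting it. This brings sums over \<alpha> to the indices (a, r) of the conditions in (M) and
  (C).\<close>

lemma sum_bits_insert_coord:
  fixes f :: "(nat \<Rightarrow> nat) \<Rightarrow> real"
  assumes k: "k \<in> {1..d}"
  shows "(\<Sum>\<alpha>\<in>bits d. f \<alpha>) = (\<Sum>a\<in>bits (d - 1). \<Sum>r\<in>{0, 1}. f (insert_coord d k a r))"
proof -
  have "(\<Sum>\<alpha>\<in>bits d. f \<alpha>) = (\<Sum>(a, r)\<in>bits (d - 1) \<times> {0, 1}. f (insert_coord d k a r))"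
  proof (rule sum.reindex_bij_witness[where i = "\<lambda>(a, r). insert_coord d k a r"
        and j = "\<lambda>\<alpha>. (delete_coord d k \<alpha>, \<alpha> k)"], goal_cases)
    case (1 \<alpha>) then show ?case using insert_delete_coord[OF bits_extensional k] by simp
  next
    case (2 \<alpha>) then show ?case using delete_coord_bits[of \<alpha> d k] bits_iff[of \<alpha> d k] k by simp
  next
    case (3 p) then show ?case
      using k delete_insert_coord[OF bits_extensional k] by (auto simp: insert_coord_def)
  next
    case (4 p) then show ?case using insert_coord_bits[OF _ _ k] by auto
  next
    case (5 \<alpha>) then show ?case using insert_delete_coord[OF bits_extensional k] by simp
  qed
  then show ?thesis by (simp only: sum.cartesian_product)
qed

section \<open>Permutations with one prescribed value\<close>

definition skip :: "nat \<Rightarrow> nat \<Rightarrow> nat" where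
  "skip k i = (if i < k then i else i + 1)"

definition unskip :: "nat \<Rightarrow> nat \<Rightarrow> nat" where
  "unskip k m = (if m < k then m else m - 1)"

lemma skip_neq: "skip k i \<noteq> k"
  by (simp add: skip_def)

lemma unskip_skip: "unskip k (skip k i) = i"
  by (simp add: skip_def unskip_def)

lemma skip_unskip: "m \<noteq> k \<Longrightarrow> skip k (unskip k m) = m"
  by (auto simp: skip_def unskip_def)

lemma skip_in: "i \<in> {1..d - 1} \<Longrightarrow> skip k i \<in> {1..d}"
  by (auto simp: skip_def)

lemma unskip_in: "m \<in> {1..d} \<Longrightarrow> m \<noteq> k \<Longrightarrow> k \<in> {1..d} \<Longrightarrow> unskip k m \<in> {1..d - 1}"
  by (auto simp: unskip_def)

text \<open>\<open>skip k\<close> enumerates increasingly the naturals other than k, and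
  \<open>unskip\<close> inverts it; the four cases of \<open>chi\<close> collapse into one
  composition. Since k is at least 1, the test \<open>b i \<le> k - 1\<close> with truncated
  subtraction is the same as \<open>b i < k\<close>.\<close>

lemma chi_eq_skip:
  assumes "k \<in> {1..d}"
  shows "chi d j b k i =
    (if i \<notin> {1..d} then i else if i = j then k else skip k (b (unskip j i)))"
  using assms by (auto simp: chi_def skip_def unskip_def)

lemma perms_outside: "\<beta> \<in> perms d \<Longrightarrow> i \<notin> {1..d} \<Longrightarrow> \<beta> i = i"
  unfolding perms_def by (auto dest: permutes_not_in)

lemma chi_perms:
  assumes b: "b \<in> perms (d - 1)" and j: "j \<in> {1..d}" and k: "k \<in> {1..d}"
  shows "chi d j b k \<in> perms d"
proof -
  have "chi d j b k permutes {1..d}"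
  proof (rule inj_imp_permutes)
    show "inj_on (chi d j b k) {1..d}"
    proof (rule inj_onI)
      fix x y assume "x \<in> {1..d}" "y \<in> {1..d}" "chi d j b k x = chi d j b k y"
      then show "x = y"
        by (metis chi_eq_skip[OF k] skip_neq unskip_skip skip_unskip perms_inverses(2)[OF b])
    qed
    fix x assume "x \<in> {1..d}"
    then show "chi d j b k x \<in> {1..d}"
      using perms_in[OF b] skip_in unskip_in[OF _ _ j] k
      by (simp only: chi_eq_skip[OF k] if_False if_True not_True_eq_False split: if_split) blast
  qed (auto simp: chi_def)
  then show ?thesis by (simp add: perms_def)
qed

text \<open>In terms of the permutation matrix of \<beta>, row j and column k are removed. For fixed
  j and k this inverts \<open>chi\<close> on the permutations with
  \<open>\<beta> j = k\<close>.\<close>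

definition unchi :: "nat \<Rightarrow> nat \<Rightarrow> nat \<Rightarrow> (nat \<Rightarrow> nat) \<Rightarrow> nat \<Rightarrow> nat" where
  "unchi d j k \<beta> i = (if i \<notin> {1..d - 1} then i else unskip k (\<beta> (skip j i)))"

lemma unchi_perms:
  assumes \<beta>: "\<beta> \<in> perms d" and j: "j \<in> {1..d}" and k: "\<beta> j = k"
  shows "unchi d j k \<beta> \<in> perms (d - 1)"
proof -
  have ne: "\<beta> (skip j x) \<noteq> k" for x
    using k skip_neq perms_inverses(2)[OF \<beta>] by metis
  have kd: "k \<in> {1..d}" using perms_in[OF \<beta>, of j] j k by simp
  have "unchi d j k \<beta> permutes {1..d - 1}"
  proof (rule inj_imp_permutes)
    show "inj_on (unchi d j k \<beta>) {1..d - 1}"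
    proof (rule inj_onI)
      fix x y assume "x \<in> {1..d - 1}" "y \<in> {1..d - 1}" "unchi d j k \<beta> x = unchi d j k \<beta> y"
      then show "x = y"
        by (metis unchi_def ne unskip_skip skip_unskip perms_inverses(2)[OF \<beta>])
    qed
    fix x assume x: "x \<in> {1..d - 1}"
    then have "\<beta> (skip j x) \<in> {1..d}" using perms_in[OF \<beta>] skip_in by blast
    from unskip_in[OF this ne kd] show "unchi d j k \<beta> x \<in> {1..d - 1}"
      using x by (simp only: unchi_def if_False not_True_eq_False)
  qed (auto simp: unchi_def)
  then show ?thesis by (simp add: perms_def)
qed

lemma chi_unchi:
  assumes \<beta>: "\<beta> \<in> perms d" and j: "j \<in> {1..d}" and k: "\<beta> j = k"
  shows "chi d j (unchi d j k \<beta>) k = \<beta>"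
proof
  fix i
  have ne: "\<beta> x \<noteq> k" if "x \<noteq> j" for x
    using perms_inverses(2)[OF \<beta>] k that by metis
  have kd: "k \<in> {1..d}" using perms_in[OF \<beta>, of j] j k by simp
  show "chi d j (unchi d j k \<beta>) k i = \<beta> i"
    using perms_outside[OF \<beta>] k skip_unskip[OF ne] skip_unskip unskip_in[OF _ _ j]
    unfolding chi_eq_skip[OF kd] unchi_def by metis
qed

lemma unchi_chi:
  assumes b: "b \<in> perms (d - 1)" and j: "j \<in> {1..d}" and k: "k \<in> {1..d}"
  shows "unchi d j k (chi d j b k) = b"
proof
  fix i
  show "unchi d j k (chi d j b k) i = b i"
  proof (cases "i \<in> {1..d - 1}")
    case True
    then show ?thesis
      using skip_in[OF True, of j]
      by (simp only: unchi_def chi_eq_skip[OF k] skip_neq unskip_skip not_True_eq_False if_False)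
  next
    case False
    then show ?thesis
      using perms_outside[OF b False] by (simp only: unchi_def not_False_eq_True if_True)
  qed
qed

lemma chi_apply: "j \<in> {1..d} \<Longrightarrow> chi d j b k j = k"
  by (simp add: chi_def)

text \<open>A permutation takes the value k at exactly one position
  \<open>j = inv \<beta> k\<close>, and what remains is a permutation of d - 1 points.\<close>

lemma sum_perms_chi:
  fixes f :: "(nat \<Rightarrow> nat) \<Rightarrow> real"
  assumes k: "k \<in> {1..d}"
  shows "(\<Sum>\<beta>\<in>perms d. f \<beta>) = (\<Sum>j\<in>{1..d}. \<Sum>b\<in>perms (d - 1). f (chi d j b k))"
proof -
  have inv_in: "inv \<beta> k \<in> {1..d}" "\<beta> (inv \<beta> k) = k" if "\<beta> \<in> perms d" for \<beta>
    using perms_in[OF perms_inv[OF that], of k] k perms_inverses[OF that] by auto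
  have inv_chi: "inv (chi d j b k) k = j" if "j \<in> {1..d}" "b \<in> perms (d - 1)" for j b
    using perms_inverses(2)[OF chi_perms[OF that(2,1) k], of j] chi_apply[OF that(1)] by simp
  have "(\<Sum>\<beta>\<in>perms d. f \<beta>) = (\<Sum>(j, b)\<in>{1..d} \<times> perms (d - 1). f (chi d j b k))"
  proof (rule sum.reindex_bij_witness[where i = "\<lambda>(j, b). chi d j b k"
        and j = "\<lambda>\<beta>. (inv \<beta> k, unchi d (inv \<beta> k) k \<beta>)"], goal_cases)
    case (1 \<beta>) then show ?case using chi_unchi inv_in by simp
  next
    case (2 \<beta>) then show ?case using unchi_perms inv_in by simp
  next
    case (3 p) then show ?case using unchi_chi k inv_chi by auto
  next
    case (4 p) then show ?case using chi_perms k by auto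
  next
    case (5 \<beta>) then show ?case using chi_unchi inv_in by simp
  qed
  then show ?thesis by (simp only: sum.cartesian_product)
qed

subsection \<open>The folded simplex\<close>

lemma Delta0_cube: "w \<in> Delta0 d \<Longrightarrow> w \<in> cube d"
  by (simp add: Delta0_def)

lemma Delta0_strict_mono:
  assumes w: "w \<in> Delta0 d" and ij: "i \<in> {1..d}" "j \<in> {1..d}" "i < j"
  shows "w i < w j"
proof -
  have "Suc i \<le> j" using ij by simp
  then show ?thesis using ij(2)
  proof (induction rule: dec_induct)
    case base
    then show ?case using w ij by (simp add: Delta0_def)
  next
    case (step n)
    then have "w n < w (n + 1)" using w ij(1) by (simp add: Delta0_def)
    with step show ?case by simp
  qed
qed

lemma Delta0_less_half:
  assumes w: "w \<in> Delta0 d" and i: "i \<in> {1..d}"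
  shows "w i < 1 / 2"
proof (cases "i = d")
  case False
  then have "w i < w d" using Delta0_strict_mono[OF w i, of d] i by simp
  also have "w d < 1 / 2" using w by (simp add: Delta0_def)
  finally show ?thesis .
qed (use w in \<open>simp add: Delta0_def\<close>)

text \<open>Both w and its rearrangement w' are strictly increasing, so \<pi> is increasing on
  \<open>{1..d}\<close>; an increasing permutation of an initial segment is the identity.\<close>

lemma Delta0_permuted_eq_imp_id:
  assumes w: "w \<in> Delta0 d" and w': "w' \<in> Delta0 d" and \<pi>: "\<pi> \<in> perms d"
    and eq: "\<And>i. i \<in> {1..d} \<Longrightarrow> w (\<pi> i) = w' i"
  shows "\<pi> = id"
proof -
  \<comment> \<open>An increasing map on integers grows by at least 1 per step and starts at 1 or
    above. A permutation that lowers no point fixes every point.\<close>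
  have ge: "i \<le> \<pi> i" if "i \<in> {1..d}" for i
  proof -
    from that have "1 \<le> i" by simp
    then show ?thesis using that
    proof (induction rule: dec_induct)
      case base
      then show ?case using perms_in[OF \<pi>, of 1] by auto
    next
      case (step n)
      then have n: "n \<in> {1..d}" "Suc n \<in> {1..d}" by auto
      have "w (\<pi> n) < w (\<pi> (Suc n))"
        using Delta0_strict_mono[OF w' n] eq n by simp
      moreover have "\<pi> n \<in> {1..d}" "\<pi> (Suc n) \<in> {1..d}" using n perms_in[OF \<pi>] by blast+
      ultimately have "\<pi> n < \<pi> (Suc n)"
        using Delta0_strict_mono[OF w, of "\<pi> (Suc n)" "\<pi> n"] by (cases "\<pi> n" "\<pi> (Suc n)" rule: linorder_cases) auto
      then show ?case using step.IH n by simp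
    qed
  qed
  show ?thesis
    using permutes_natset_ge[of \<pi> "{1..d}"] \<pi> ge by (auto simp: perms_def)
qed

text \<open>This is the disjointness of the cells. Entries of a simplex point lie strictly below 1/2
  and their reflections strictly above, so the side of 1/2 on which each coordinate falls reveals
  \<alpha>; the order of the unreflected coordinates then reveals \<beta>.\<close>

lemma tau_sigma_inj:
  assumes w: "w \<in> Delta0 d" and w': "w' \<in> Delta0 d"
    and \<alpha>: "\<alpha> \<in> bits d" "\<alpha>' \<in> bits d" and \<beta>: "\<beta> \<in> perms d" "\<beta>' \<in> perms d"
    and eq: "tau_act d \<alpha> (sigma_act d (inv \<beta>) w) = tau_act d \<alpha>' (sigma_act d (inv \<beta>') w')"
  shows "\<alpha> = \<alpha>' \<and> \<beta> = \<beta>'"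
proof -
  have val: "(if \<alpha> i = 1 then 1 - w (inv \<beta> i) else w (inv \<beta> i)) =
      (if \<alpha>' i = 1 then 1 - w' (inv \<beta>' i) else w' (inv \<beta>' i))" if "i \<in> {1..d}" for i
    using fun_cong[OF eq, of i] by (simp only: tau_act_apply[OF \<alpha>(1) that] tau_act_apply[OF \<alpha>(2) that]
        sigma_act_def restrict_apply that if_True)
  have half: "w (inv \<beta> i) < 1 / 2" "w' (inv \<beta>' i) < 1 / 2" if "i \<in> {1..d}" for i
    using Delta0_less_half[OF w] Delta0_less_half[OF w'] perms_in perms_inv \<beta> that by metis+
  have \<alpha>_eq: "\<alpha> i = \<alpha>' i" if "i \<in> {1..d}" for i
    using val[OF that] half[OF that] bits_iff[OF \<alpha>(1) that] bits_iff[OF \<alpha>(2) that]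
    by (auto split: if_splits)
  have w_eq: "w (inv \<beta> i) = w' (inv \<beta>' i)" if "i \<in> {1..d}" for i
    using val[OF that] \<alpha>_eq[OF that] by (auto split: if_splits)
  \<comment> \<open>This is the permutation that rearranges w into w'.\<close>
  have \<pi>: "inv \<beta> \<circ> \<beta>' \<in> perms d"
    using \<beta> by (auto simp: perms_def intro: permutes_compose permutes_inv)
  have "inv \<beta> \<circ> \<beta>' = id"
  proof (rule Delta0_permuted_eq_imp_id[OF w w' \<pi>])
    fix i assume "i \<in> {1..d}"
    then have "\<beta>' i \<in> {1..d}" using perms_in[OF \<beta>(2)] by blast
    from w_eq[OF this] show "w ((inv \<beta> \<circ> \<beta>') i) = w' i" by (simp add: perms_inverses[OF \<beta>(2)])
  qed
  then have "\<beta>' i = \<beta> i" for i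
    using perms_inverses(1)[OF \<beta>(1), of "\<beta>' i"] by (metis comp_apply id_apply)
  moreover have "\<alpha> = \<alpha>'"
    using \<alpha> \<alpha>_eq unfolding bits_def by (rule PiE_ext)
  ultimately show ?thesis by auto
qed

subsection \<open>The perturbed density\<close>

lemma integrable_mult_indicator_set:
  assumes "integrable M f" "A \<in> sets M"
  shows "integrable M (\<lambda>u. f u * indicator A u :: real)"
  using integrable_mult_indicator[OF assms(2,1)] by (simp add: mult.commute)

text \<open>The bound by a minimum becomes one product inequality for each pair with positive
  \<epsilon>. This form avoids both division and the value \<open>+\<infinity>\<close> of an empty
  minimum.\<close>

locale perturbed_density =
  fixes d :: nat and c \<gamma> :: "(nat \<Rightarrow> real) \<Rightarrow> real"
    and \<epsilon> :: "(nat \<Rightarrow> nat) \<times> (nat \<Rightarrow> nat) \<Rightarrow> real"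
  assumes d_pos: "d \<ge> 1"
    and c_density: "prob_density d c"
    and \<gamma>_integrable: "set_integrable (cube_lborel d) (Delta0 d) \<gamma>"
    and \<gamma>_nonneg: "\<And>u. u \<in> Delta0 d \<Longrightarrow> 0 \<le> \<gamma> u"
    and \<gamma>_bound: "\<And>\<alpha> \<beta> u. \<lbrakk>\<alpha> \<in> bits d; \<beta> \<in> perms d; 0 < \<epsilon> (\<alpha>, \<beta>); u \<in> Delta0 d\<rbrakk> \<Longrightarrow>
      \<epsilon> (\<alpha>, \<beta>) * \<gamma> u \<le> c (tau_act d \<alpha> (sigma_act d (inv \<beta>) u))"
begin

abbreviation "\<Phi> \<alpha> \<beta> u \<equiv> sigma_act d \<beta> (tau_act d \<alpha> u)"
abbreviation "\<Psi> \<alpha> \<beta> w \<equiv> tau_act d \<alpha> (sigma_act d (inv \<beta>) w)"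

text \<open>\<gamma> is controlled only on the simplex; extending it by zero also absorbs the
  indicator of \<open>Delta d \<alpha> \<beta>\<close> into
  \<open>G (\<Phi> \<alpha> \<beta> u)\<close>.\<close>

definition G :: "(nat \<Rightarrow> real) \<Rightarrow> real" where
  "G w = indicator (Delta0 d) w * \<gamma> w"

lemma G_integrable: "integrable (cube_lborel d) G"
  using \<gamma>_integrable by (simp add: set_integrable_def G_def[abs_def])

lemma G_measurable [measurable]: "G \<in> borel_measurable (cube_lborel d)"
  using G_integrable by (rule borel_measurable_integrable)

lemma G_nonneg: "0 \<le> G w"
  using \<gamma>_nonneg by (simp add: G_def indicator_def)

text \<open>A nonnegative function with zero integral vanishes almost everywhere. This is the factor
  that the converses of (D) and (G) cancel.\<close>

lemma integral_G_pos:
  assumes "\<not> (AE u in cube_lborel d. u \<in> Delta0 d \<longrightarrow> \<gamma> u = 0)"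
  shows "0 < (\<integral>w. G w \<partial>cube_lborel d)"
proof -
  have "\<not> (AE u in cube_lborel d. G u = 0)"
    using assms by (auto simp: G_def indicator_def cong: AE_cong)
  then have "(\<integral>w. G w \<partial>cube_lborel d) \<noteq> 0"
    using integral_nonneg_eq_0_iff_AE[OF G_integrable] G_nonneg by simp
  then show ?thesis using Bochner_Integration.integral_nonneg[of "cube_lborel d" G, OF G_nonneg] by simp
qed

lemma c_measurable [measurable]: "c \<in> borel_measurable (cube_lborel d)"
  and c_nonneg: "u \<in> cube d \<Longrightarrow> 0 \<le> c u"
  using c_density by (auto simp: prob_density_def)

lemma c_integrable: "integrable (cube_lborel d) c"
  using c_density by (intro integrableI_nonneg) (auto simp: prob_density_def)

lemma integral_c: "(\<integral>u. c u \<partial>cube_lborel d) = 1"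
  using c_density by (subst integral_eq_nn_integral) (auto simp: prob_density_def)

lemma theta_eq:
  assumes "u \<in> cube d"
  shows "theta d c \<epsilon> \<gamma> u = c u - (\<Sum>\<alpha>\<in>bits d. \<Sum>\<beta>\<in>perms d. \<epsilon> (\<alpha>, \<beta>) * G (\<Phi> \<alpha> \<beta> u))"
proof -
  have "(\<Sum>(\<alpha>, \<beta>)\<in>bits d \<times> perms d. \<epsilon> (\<alpha>, \<beta>) * \<gamma> (\<Phi> \<alpha> \<beta> u) * indicator (Delta d \<alpha> \<beta>) u)
      = (\<Sum>(\<alpha>, \<beta>)\<in>bits d \<times> perms d. \<epsilon> (\<alpha>, \<beta>) * G (\<Phi> \<alpha> \<beta> u))"
    using assms by (intro sum.cong) (auto simp: G_def Delta_def indicator_def)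
  then show ?thesis by (simp only: theta_def sum.cartesian_product)
qed

text \<open>At most one summand is nonzero at u. If its coefficient is positive, the bound on
  \<gamma> at \<open>\<Phi> \<alpha> \<beta> u\<close> bounds it by \<open>c u\<close>, because
  \<open>\<Psi>\<close> undoes \<open>\<Phi>\<close>; otherwise the summand is at most 0 and
  \<open>c u\<close> is nonnegative.\<close>

lemma theta_nonneg:
  assumes u: "u \<in> cube d"
  shows "0 \<le> theta d c \<epsilon> \<gamma> u"
proof -
  let ?f = "\<lambda>(\<alpha>, \<beta>). \<epsilon> (\<alpha>, \<beta>) * G (\<Phi> \<alpha> \<beta> u)"
  have "(\<Sum>p\<in>bits d \<times> perms d. ?f p) \<le> c u"
  proof (cases "\<exists>p\<in>bits d \<times> perms d. \<Phi> (fst p) (snd p) u \<in> Delta0 d")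
    case False
    then have "(\<Sum>p\<in>bits d \<times> perms d. ?f p) = 0"
      by (intro sum.neutral) (auto simp: G_def indicator_def)
    then show ?thesis using c_nonneg[OF u] by simp
  next
    case True
    then obtain \<alpha> \<beta> where \<alpha>\<beta>: "\<alpha> \<in> bits d" "\<beta> \<in> perms d" and w: "\<Phi> \<alpha> \<beta> u \<in> Delta0 d"
      by auto
    have "?f p = 0" if p: "p \<in> bits d \<times> perms d - {(\<alpha>, \<beta>)}" for p
    proof -
      obtain \<alpha>' \<beta>' where p': "p = (\<alpha>', \<beta>')" "\<alpha>' \<in> bits d" "\<beta>' \<in> perms d" using p by auto
      \<comment> \<open>Otherwise u would be the image of a simplex point under two different
        pairs.\<close>
      have "\<Phi> \<alpha>' \<beta>' u \<notin> Delta0 d"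
      proof
        assume "\<Phi> \<alpha>' \<beta>' u \<in> Delta0 d"
        from tau_sigma_inj[OF w this \<alpha>\<beta>(1) p'(2) \<alpha>\<beta>(2) p'(3)]
        show False
          using p p' \<alpha>\<beta> u by (simp add: tau_sigma_left_inverse)
      qed
      then show ?thesis by (simp add: p' G_def)
    qed
    then have "(\<Sum>p\<in>bits d \<times> perms d. ?f p) = ?f (\<alpha>, \<beta>)"
      using \<alpha>\<beta> by (subst sum.remove[of _ "(\<alpha>, \<beta>)"]) auto
    also have "\<dots> \<le> c u"
    proof (cases "\<epsilon> (\<alpha>, \<beta>) > 0")
      case True
      then show ?thesis
        using \<gamma>_bound[OF \<alpha>\<beta> True w] w u \<alpha>\<beta> by (simp add: G_def tau_sigma_left_inverse)
    next
      case False
      then have "?f (\<alpha>, \<beta>) \<le> 0" using G_nonneg by (simp add: mult_nonpos_nonneg)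
      then show ?thesis using c_nonneg[OF u] by simp
    qed
    finally show ?thesis .
  qed
  then show ?thesis by (simp add: theta_eq[OF u] sum.cartesian_product)
qed

lemma \<Phi>_measurable [measurable]:
  "\<alpha> \<in> bits d \<Longrightarrow> \<beta> \<in> perms d \<Longrightarrow> (\<lambda>u. \<Phi> \<alpha> \<beta> u) \<in> measurable (cube_lborel d) (cube_lborel d)"
  by (rule sigma_tau_measurable)

lemma \<Psi>_measurable [measurable]:
  "\<alpha> \<in> bits d \<Longrightarrow> \<beta> \<in> perms d \<Longrightarrow> (\<lambda>u. \<Psi> \<alpha> \<beta> u) \<in> measurable (cube_lborel d) (cube_lborel d)"
  by (rule tau_sigma_inv_measurable)

lemma integral_G_\<Phi>:
  assumes \<alpha>\<beta>: "\<alpha> \<in> bits d" "\<beta> \<in> perms d" and A: "A \<in> sets (cube_lborel d)"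
  shows "integrable (cube_lborel d) (\<lambda>u. G (\<Phi> \<alpha> \<beta> u) * indicator A u)"
    and "(\<integral>u. G (\<Phi> \<alpha> \<beta> u) * indicator A u \<partial>cube_lborel d)
      = (\<integral>w. G w * indicator A (\<Psi> \<alpha> \<beta> w) \<partial>cube_lborel d)"
proof -
  let ?M = "cube_lborel d"
  have "integrable (distr ?M ?M (\<Phi> \<alpha> \<beta>)) G"
    using G_integrable by (simp add: distr_sigma_tau[OF \<alpha>\<beta>])
  then have "integrable ?M (\<lambda>u. G (\<Phi> \<alpha> \<beta> u))"
    by (rule integrable_distr[OF \<Phi>_measurable[OF \<alpha>\<beta>]])
  then show "integrable ?M (\<lambda>u. G (\<Phi> \<alpha> \<beta> u) * indicator A u)"
    using A by (rule integrable_mult_indicator_set)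
  have meas: "(\<lambda>w. G w * indicator A (\<Psi> \<alpha> \<beta> w)) \<in> borel_measurable ?M"
    by (intro borel_measurable_times G_measurable
        measurable_compose[OF \<Psi>_measurable[OF \<alpha>\<beta>] borel_measurable_indicator[OF A]])
  \<comment> \<open>Replacing u by
    \<open>\<Psi> \<alpha> \<beta> (\<Phi> \<alpha> \<beta> u)\<close> makes the whole integrand a
    function of \<open>\<Phi> \<alpha> \<beta> u\<close>, so it can be pushed forward along a
    measure-preserving map.\<close>
  have "(\<integral>u. G (\<Phi> \<alpha> \<beta> u) * indicator A u \<partial>?M)
      = (\<integral>u. G (\<Phi> \<alpha> \<beta> u) * indicator A (\<Psi> \<alpha> \<beta> (\<Phi> \<alpha> \<beta> u)) \<partial>?M)"
    by (rule Bochner_Integration.integral_cong) (simp_all add: tau_sigma_left_inverse \<alpha>\<beta>)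
  also have "\<dots> = (\<integral>w. G w * indicator A (\<Psi> \<alpha> \<beta> w) \<partial>distr ?M ?M (\<Phi> \<alpha> \<beta>))"
    by (rule integral_distr[OF \<Phi>_measurable[OF \<alpha>\<beta>] meas, symmetric])
  finally show "(\<integral>u. G (\<Phi> \<alpha> \<beta> u) * indicator A u \<partial>?M)
      = (\<integral>w. G w * indicator A (\<Psi> \<alpha> \<beta> w) \<partial>?M)"
    by (simp add: distr_sigma_tau[OF \<alpha>\<beta>])
qed

lemma theta_measurable: "theta d c \<epsilon> \<gamma> \<in> borel_measurable (cube_lborel d)"
proof -
  have "(\<lambda>u. c u - (\<Sum>\<alpha>\<in>bits d. \<Sum>\<beta>\<in>perms d. \<epsilon> (\<alpha>, \<beta>) * G (\<Phi> \<alpha> \<beta> u))) \<in> borel_measurable (cube_lborel d)"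
    by (intro borel_measurable_diff borel_measurable_sum borel_measurable_times borel_measurable_const
        c_measurable measurable_compose[OF \<Phi>_measurable G_measurable])
  then show ?thesis using theta_eq by (subst measurable_cong) auto
qed

lemma integral_theta:
  assumes A: "A \<in> sets (cube_lborel d)"
  shows "integrable (cube_lborel d) (\<lambda>u. theta d c \<epsilon> \<gamma> u * indicator A u)" (is ?int)
    and "(\<integral>u. theta d c \<epsilon> \<gamma> u * indicator A u \<partial>cube_lborel d)
      = (\<integral>u. c u * indicator A u \<partial>cube_lborel d)
        - (\<Sum>\<alpha>\<in>bits d. \<Sum>\<beta>\<in>perms d. \<epsilon> (\<alpha>, \<beta>) * (\<integral>w. G w * indicator A (\<Psi> \<alpha> \<beta> w) \<partial>cube_lborel d))"
      (is "?I = ?J")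
proof -
  let ?M = "cube_lborel d"
  let ?S = "\<lambda>u. (\<Sum>\<alpha>\<in>bits d. \<Sum>\<beta>\<in>perms d. \<epsilon> (\<alpha>, \<beta>) * (G (\<Phi> \<alpha> \<beta> u) * indicator A u))"
  have eq: "theta d c \<epsilon> \<gamma> u * indicator A u = c u * indicator A u - ?S u" if "u \<in> space ?M" for u
    using that by (simp add: theta_eq left_diff_distrib sum_distrib_right mult.assoc)
  have int_c: "integrable ?M (\<lambda>u. c u * indicator A u)"
    using c_integrable A by (rule integrable_mult_indicator_set)
  have int_t: "integrable ?M (\<lambda>u. \<epsilon> (\<alpha>, \<beta>) * (G (\<Phi> \<alpha> \<beta> u) * indicator A u))"
    if "\<alpha> \<in> bits d" "\<beta> \<in> perms d" for \<alpha> \<beta>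
    using integral_G_\<Phi>(1)[OF that A] by (rule integrable_mult_right)
  have int_S: "integrable ?M ?S"
    by (intro Bochner_Integration.integrable_sum int_t)
  have "integrable ?M (\<lambda>u. c u * indicator A u - ?S u)"
    using int_c int_S by (rule Bochner_Integration.integrable_diff)
  then show ?int using eq by (subst Bochner_Integration.integrable_cong[OF refl eq]) auto
  have "?I = (\<integral>u. c u * indicator A u - ?S u \<partial>?M)"
    using eq by (rule Bochner_Integration.integral_cong[OF refl])
  also have "\<dots> = (\<integral>u. c u * indicator A u \<partial>?M) - (\<integral>u. ?S u \<partial>?M)"
    using int_c int_S by (rule Bochner_Integration.integral_diff)
  also have "(\<integral>u. ?S u \<partial>?M) = (\<Sum>\<alpha>\<in>bits d. \<Sum>\<beta>\<in>perms d.
      \<epsilon> (\<alpha>, \<beta>) * (\<integral>w. G w * indicator A (\<Psi> \<alpha> \<beta> w) \<partial>?M))"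
    using int_t integral_G_\<Phi>[OF _ _ A]
    by (simp add: Bochner_Integration.integral_sum Bochner_Integration.integrable_sum cong: sum.cong)
  finally show "?I = ?J" .
qed

text \<open>Measurability and nonnegativity are already settled, so only the total mass matters, and
  it is 1 minus this product. The product is kept because its second factor may vanish.\<close>

lemma prob_density_theta_iff:
  "prob_density d (theta d c \<epsilon> \<gamma>) \<longleftrightarrow>
    (\<Sum>(\<alpha>, \<beta>)\<in>bits d \<times> perms d. \<epsilon> (\<alpha>, \<beta>)) * (\<integral>w. G w \<partial>cube_lborel d) = 0"
proof -
  let ?M = "cube_lborel d"
  have full: "cube d \<in> sets ?M" using sets.top[of ?M] by simp
  have ind: "(\<integral>u. f u * indicator (cube d) (h u) \<partial>?M) = (\<integral>u. f u \<partial>?M)"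
    if "\<And>u. u \<in> cube d \<Longrightarrow> h u \<in> cube d" for f :: "_ \<Rightarrow> real" and h
    using that by (intro Bochner_Integration.integral_cong) auto
  have "integrable ?M (theta d c \<epsilon> \<gamma>)"
    using integral_theta(1)[OF full] by (rule Bochner_Integration.integrable_cong[THEN iffD1, OF refl, rotated]) simp
  then have "(\<integral>\<^sup>+u. ennreal (theta d c \<epsilon> \<gamma> u) \<partial>?M) = ennreal (\<integral>u. theta d c \<epsilon> \<gamma> u \<partial>?M)"
    using theta_nonneg by (intro nn_integral_eq_integral) auto
  moreover have "(\<integral>u. theta d c \<epsilon> \<gamma> u \<partial>?M) = 1 - (\<Sum>\<alpha>\<in>bits d. \<Sum>\<beta>\<in>perms d. \<epsilon> (\<alpha>, \<beta>) * (\<integral>w. G w \<partial>?M))"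
    using integral_theta(2)[OF full] integral_c perms_inv
    by (simp add: ind sigma_act_cube tau_act_cube cong: sum.cong)
  ultimately show ?thesis
    using theta_measurable theta_nonneg
    by (auto simp: prob_density_def sum.cartesian_product split_def sum_distrib_right ennreal_eq_1)
qed

abbreviation law :: "((nat \<Rightarrow> real) \<Rightarrow> real) \<Rightarrow> (nat \<Rightarrow> real) measure" where
  "law f \<equiv> density (cube_lborel d) (\<lambda>u. ennreal (f u))"

text \<open>Both measures of A are finite and equal to real integrals of nonnegative functions, so
  the comparison can be made by subtraction in the reals.\<close>

lemma emeasure_law_theta_eq_iff:
  assumes A: "A \<in> sets (cube_lborel d)"
  shows "emeasure (law (theta d c \<epsilon> \<gamma>)) A = emeasure (law c) A \<longleftrightarrow>
    (\<Sum>\<alpha>\<in>bits d. \<Sum>\<beta>\<in>perms d. \<epsilon> (\<alpha>, \<beta>) * (\<integral>w. G w * indicator A (\<Psi> \<alpha> \<beta> w) \<partial>cube_lborel d)) = 0"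
proof -
  let ?M = "cube_lborel d"
  have law: "emeasure (law f) A = ennreal (\<integral>u. f u * indicator A u \<partial>?M)"
    "0 \<le> (\<integral>u. f u * indicator A u \<partial>?M)"
    if "f \<in> borel_measurable ?M" "\<And>u. u \<in> cube d \<Longrightarrow> 0 \<le> f u"
      and int: "integrable ?M (\<lambda>u. f u * indicator A u)" for f
  proof -
    have "emeasure (law f) A = (\<integral>\<^sup>+u. ennreal (f u * indicator A u) \<partial>?M)"
      using that A by (subst emeasure_density) (auto intro!: nn_integral_cong simp: indicator_def)
    also have "\<dots> = ennreal (\<integral>u. f u * indicator A u \<partial>?M)"
      using int that(2) by (intro nn_integral_eq_integral) auto
    finally show "emeasure (law f) A = \<dots>" .
    show "0 \<le> (\<integral>u. f u * indicator A u \<partial>?M)"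
      using that(2) by (intro Bochner_Integration.integral_nonneg) auto
  qed
  note law_c = law[OF c_measurable c_nonneg integrable_mult_indicator_set[OF c_integrable A]]
  note law_\<theta> = law[OF theta_measurable theta_nonneg integral_theta(1)[OF A]]
  have "emeasure (law (theta d c \<epsilon> \<gamma>)) A = emeasure (law c) A \<longleftrightarrow>
    (\<integral>u. theta d c \<epsilon> \<gamma> u * indicator A u \<partial>?M) = (\<integral>u. c u * indicator A u \<partial>?M)"
    using law_c law_\<theta> by simp
  then show ?thesis using integral_theta(2)[OF A] by linarith
qed

text \<open>Common criterion for (G), (M) and (C), which differ only in the choice of h. As
  \<open>\<Psi> \<alpha> \<beta> w\<close> stays in the cube, membership in the preimage of B is
  just \<open>h (\<Psi> \<alpha> \<beta> w) \<in> B\<close>.\<close>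

lemma distr_law_theta_eq:
  assumes h: "h \<in> measurable (cube_lborel d) L"
    and zero: "\<And>B. B \<in> sets L \<Longrightarrow>
      (\<Sum>\<alpha>\<in>bits d. \<Sum>\<beta>\<in>perms d. \<epsilon> (\<alpha>, \<beta>) * (\<integral>w. G w * indicator B (h (\<Psi> \<alpha> \<beta> w)) \<partial>cube_lborel d)) = 0"
  shows "distr (law (theta d c \<epsilon> \<gamma>)) L h = distr (law c) L h"
proof (rule measure_eqI)
  fix B assume "B \<in> sets (distr (law (theta d c \<epsilon> \<gamma>)) L h)"
  then have B: "B \<in> sets L" by simp
  let ?A = "h -` B \<inter> cube d"
  have A: "?A \<in> sets (cube_lborel d)" using measurable_sets[OF h B] by simp
  have "(\<integral>w. G w * indicator ?A (\<Psi> \<alpha> \<beta> w) \<partial>cube_lborel d) = (\<integral>w. G w * indicator B (h (\<Psi> \<alpha> \<beta> w)) \<partial>cube_lborel d)"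
    if "\<alpha> \<in> bits d" "\<beta> \<in> perms d" for \<alpha> \<beta>
    using that perms_inv
    by (intro Bochner_Integration.integral_cong) (auto simp: indicator_def sigma_act_cube tau_act_cube)
  then have "emeasure (law (theta d c \<epsilon> \<gamma>)) ?A = emeasure (law c) ?A"
    using zero[OF B] by (subst emeasure_law_theta_eq_iff[OF A]) (simp cong: sum.cong)
  then show "emeasure (distr (law (theta d c \<epsilon> \<gamma>)) L h) B = emeasure (distr (law c) L h) B"
    using h B by (simp add: emeasure_distr)
qed simp

subsection \<open>Equality of the derived laws\<close>

text \<open>For each fixed \<beta>, the map \<open>sigma_act d \<beta>\<close> permutes
  \<open>bits d\<close>; reindexing by it gathers the coefficients into the sums of condition
  (G).\<close>

lemma sum_symmetric:
  assumes "\<And>\<alpha> \<beta>. \<alpha> \<in> bits d \<Longrightarrow> \<beta> \<in> perms d \<Longrightarrow> F \<alpha> \<beta> = K (sigma_act d \<beta> \<alpha>)"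
  shows "(\<Sum>\<alpha>\<in>bits d. \<Sum>\<beta>\<in>perms d. \<epsilon> (\<alpha>, \<beta>) * F \<alpha> \<beta>)
    = (\<Sum>\<alpha>\<in>bits d. (\<Sum>\<beta>\<in>perms d. \<epsilon> (sigma_act d (inv \<beta>) \<alpha>, \<beta>)) * K \<alpha>)"
proof -
  have "(\<Sum>\<alpha>\<in>bits d. \<Sum>\<beta>\<in>perms d. \<epsilon> (\<alpha>, \<beta>) * F \<alpha> \<beta>)
      = (\<Sum>\<beta>\<in>perms d. \<Sum>\<alpha>\<in>bits d. \<epsilon> (\<alpha>, \<beta>) * K (sigma_act d \<beta> \<alpha>))"
    using assms by (subst sum.swap) (simp cong: sum.cong)
  also have "\<dots> = (\<Sum>\<beta>\<in>perms d. \<Sum>\<alpha>\<in>bits d. \<epsilon> (sigma_act d (inv \<beta>) \<alpha>, \<beta>) * K \<alpha>)"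
  proof (rule sum.cong[OF refl])
    fix \<beta> assume \<beta>: "\<beta> \<in> perms d"
    show "(\<Sum>\<alpha>\<in>bits d. \<epsilon> (\<alpha>, \<beta>) * K (sigma_act d \<beta> \<alpha>))
        = (\<Sum>\<alpha>\<in>bits d. \<epsilon> (sigma_act d (inv \<beta>) \<alpha>, \<beta>) * K \<alpha>)"
      by (rule sum.reindex_bij_witness[of _ "sigma_act d (inv \<beta>)" "sigma_act d \<beta>"])
         (simp_all add: sigma_act_inv[OF \<beta> bits_extensional] sigma_act_bits \<beta> perms_inv)
  qed
  also have "\<dots> = (\<Sum>\<alpha>\<in>bits d. (\<Sum>\<beta>\<in>perms d. \<epsilon> (sigma_act d (inv \<beta>) \<alpha>, \<beta>)) * K \<alpha>)"
    by (subst sum.swap) (simp only: sum_distrib_right)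
  finally show ?thesis .
qed

lemma symmetric_\<Psi>:
  assumes g: "symmetric_fun d g" and \<alpha>: "\<alpha> \<in> bits d" and \<beta>: "\<beta> \<in> perms d" and w: "w \<in> cube d"
  shows "g (\<Psi> \<alpha> \<beta> w) = g (tau_act d (sigma_act d \<beta> \<alpha>) w)"
proof -
  have "tau_act d (sigma_act d \<beta> \<alpha>) w \<in> cube d"
    using \<alpha> \<beta> w by (intro tau_act_cube sigma_act_bits)
  then show ?thesis
    using g perms_inv[OF \<beta>] by (simp add: tau_sigma_commute[OF \<alpha> \<beta> w] symmetric_fun_def)
qed

lemma symmetric_law_eq:
  fixes g :: "(nat \<Rightarrow> real) \<Rightarrow> real"
  assumes zero: "\<forall>\<alpha>\<in>bits d. (\<Sum>\<beta>\<in>perms d. \<epsilon> (sigma_act d (inv \<beta>) \<alpha>, \<beta>)) = 0"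
    and g: "g \<in> borel_measurable (cube_lborel d)" "symmetric_fun d g"
  shows "distr (law (theta d c \<epsilon> \<gamma>)) borel g = distr (law c) borel g"
proof (rule distr_law_theta_eq[OF g(1)])
  fix B :: "real set"
  have "(\<Sum>\<alpha>\<in>bits d. \<Sum>\<beta>\<in>perms d. \<epsilon> (\<alpha>, \<beta>) * (\<integral>w. G w * indicator B (g (\<Psi> \<alpha> \<beta> w)) \<partial>cube_lborel d))
    = (\<Sum>\<alpha>\<in>bits d. (\<Sum>\<beta>\<in>perms d. \<epsilon> (sigma_act d (inv \<beta>) \<alpha>, \<beta>)) *
        (\<integral>w. G w * indicator B (g (tau_act d \<alpha> w)) \<partial>cube_lborel d))"
    using symmetric_\<Psi>[OF g(2)] by (intro sum_symmetric Bochner_Integration.integral_cong) simp_all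
  then show "(\<Sum>\<alpha>\<in>bits d. \<Sum>\<beta>\<in>perms d. \<epsilon> (\<alpha>, \<beta>) *
      (\<integral>w. G w * indicator B (g (\<Psi> \<alpha> \<beta> w)) \<partial>cube_lborel d)) = 0"
    using zero by simp
qed

lemma symmetric_law_eq_imp_zero:
  assumes eq: "\<And>g :: (nat \<Rightarrow> real) \<Rightarrow> real. g \<in> borel_measurable (cube_lborel d) \<Longrightarrow> symmetric_fun d g \<Longrightarrow>
      distr (law (theta d c \<epsilon> \<gamma>)) borel g = distr (law c) borel g"
    and pos: "0 < (\<integral>w. G w \<partial>cube_lborel d)" and \<alpha>: "\<alpha> \<in> bits d"
  shows "(\<Sum>\<beta>\<in>perms d. \<epsilon> (sigma_act d (inv \<beta>) \<alpha>, \<beta>)) = 0"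
proof -
  let ?M = "cube_lborel d"
  \<comment> \<open>The orbit of the cell \<open>tau_act d \<alpha> ` Delta0 d\<close>: its indicator is a symmetric function
    that detects \<open>\<alpha>\<close> alone.\<close>
  define A where "A = {u \<in> cube d. \<exists>\<beta>\<in>perms d. tau_act d \<alpha> (sigma_act d \<beta> u) \<in> Delta0 d}"
  define S where "S \<alpha>' = (\<Sum>\<beta>\<in>perms d. \<epsilon> (sigma_act d (inv \<beta>) \<alpha>', \<beta>))" for \<alpha>'
  have "A = (\<Union>\<beta>\<in>perms d. (\<lambda>u. tau_act d \<alpha> (sigma_act d \<beta> u)) -` Delta0 d \<inter> space ?M)"
    by (auto simp: A_def)
  moreover have "(\<lambda>u. tau_act d \<alpha> (sigma_act d \<beta> u)) -` Delta0 d \<inter> space ?M \<in> sets ?M"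
    if "\<beta> \<in> perms d" for \<beta>
    by (rule measurable_sets[OF measurable_compose[OF sigma_act_measurable[OF that] tau_act_measurable[OF \<alpha>]]
          Delta0_in_sets[OF d_pos]])
  ultimately have A: "A \<in> sets ?M" by (simp only: sets.finite_UN finite_perms)
  have sym: "symmetric_fun d (indicator A :: _ \<Rightarrow> real)"
    unfolding symmetric_fun_def
  proof (intro ballI)
    fix \<beta> u assume \<beta>: "\<beta> \<in> perms d" and u: "u \<in> cube d"
    \<comment> \<open>One implication suffices: applied to \<open>inv \<beta>\<close> and the
      permuted point, it yields the other.\<close>
    have *: "v \<in> A" if \<beta>: "\<beta> \<in> perms d" and v: "v \<in> cube d" and \<beta>v: "sigma_act d \<beta> v \<in> A" for \<beta> v
    proof -
      obtain \<beta>' where \<beta>': "\<beta>' \<in> perms d" "tau_act d \<alpha> (sigma_act d \<beta>' (sigma_act d \<beta> v)) \<in> Delta0 d"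
        using \<beta>v unfolding A_def by blast
      then show ?thesis
        using perms_comp[OF \<beta> \<beta>'(1)] v unfolding A_def sigma_act_comp[OF \<beta>'(1)] by blast
    qed
    have "sigma_act d \<beta> u \<in> A \<longleftrightarrow> u \<in> A"
      using *[OF \<beta> u] *[OF perms_inv[OF \<beta>] sigma_act_cube[OF \<beta> u]]
      by (auto simp: sigma_act_inv(2)[OF \<beta> cube_extensional[OF u]])
    then show "indicator A (sigma_act d \<beta> u) = (indicator A u :: real)" by (simp add: indicator_def)
  qed
  have detect: "G w * indicator A (tau_act d \<alpha>' w) = (if \<alpha>' = \<alpha> then G w else 0)"
    if \<alpha>': "\<alpha>' \<in> bits d" and w_cube: "w \<in> cube d" for \<alpha>' w
  proof (cases "w \<in> Delta0 d")
    case w: True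
    have id: "id \<in> perms d" "sigma_act d id w = w"
      using cube_extensional[OF w_cube] by (auto simp: perms_def permutes_id sigma_act_def extensional_restrict)
    have "tau_act d \<alpha>' w \<in> A \<longleftrightarrow> \<alpha>' = \<alpha>"
    proof
      assume "tau_act d \<alpha>' w \<in> A"
      then obtain \<beta> where \<beta>: "\<beta> \<in> perms d" and w': "tau_act d \<alpha> (sigma_act d \<beta> (tau_act d \<alpha>' w)) \<in> Delta0 d"
        by (auto simp: A_def)
      let ?w' = "tau_act d \<alpha> (sigma_act d \<beta> (tau_act d \<alpha>' w))"
      \<comment> \<open>Chosen so that \<open>sigma_act d \<beta> ?a = \<alpha>\<close>. Commuting
        flips and permutations then writes \<open>tau_act d \<alpha>' w\<close> as
        \<open>\<Psi> ?a \<beta> ?w'\<close>, the form in which disjointness of the cells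
        applies.\<close>
      let ?a = "sigma_act d (inv \<beta>) \<alpha>"
      have u: "tau_act d \<alpha>' w \<in> cube d" using \<alpha>' w_cube by (rule tau_act_cube)
      have a: "?a \<in> bits d" using \<alpha> \<beta> by (intro sigma_act_bits perms_inv)
      have "\<Psi> ?a \<beta> ?w' = sigma_act d (inv \<beta>) (tau_act d \<alpha> ?w')"
        by (simp add: tau_sigma_commute[OF a \<beta> Delta0_cube[OF w']] sigma_act_inv[OF \<beta> bits_extensional[OF \<alpha>]])
      also have "\<dots> = tau_act d \<alpha>' w"
        using \<alpha> u \<beta> by (simp add: tau_act_tau_act sigma_act_cube sigma_act_inv[OF \<beta> cube_extensional])
      also have "\<dots> = \<Psi> \<alpha>' id w" using id by simp
      finally have "?a = \<alpha>' \<and> \<beta> = id"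
        by (rule tau_sigma_inj[OF w' w a \<alpha>' \<beta> id(1)])
      then show "\<alpha>' = \<alpha>"
        using bits_extensional[OF \<alpha>] by (auto simp: sigma_act_def extensional_restrict)
    next
      assume "\<alpha>' = \<alpha>"
      moreover have "sigma_act d id (tau_act d \<alpha> w) = tau_act d \<alpha> w"
        using tau_act_cube[OF \<alpha> w_cube, THEN cube_extensional] by (simp add: sigma_act_def extensional_restrict)
      ultimately show "tau_act d \<alpha>' w \<in> A"
        unfolding A_def using id(1) w w_cube \<alpha> by (auto simp: tau_act_cube tau_act_tau_act intro!: bexI[of _ id])
    qed
    then show ?thesis by (auto simp: indicator_def)
  qed (simp add: G_def)
  have "distr (law (theta d c \<epsilon> \<gamma>)) borel (indicator A :: _ \<Rightarrow> real) = distr (law c) borel (indicator A)"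
    by (rule eq[OF borel_measurable_indicator[OF A] sym])
  \<comment> \<open>The mass that the law of the indicator gives to the point 1 is the mass of
    A.\<close>
  then have "emeasure (distr (law (theta d c \<epsilon> \<gamma>)) borel (indicator A :: _ \<Rightarrow> real)) {1}
      = emeasure (distr (law c) borel (indicator A :: _ \<Rightarrow> real)) {1}" by simp
  moreover have "(indicator A :: _ \<Rightarrow> real) -` {1} \<inter> cube d = A"
    by (auto simp: A_def indicator_def)
  ultimately have "emeasure (law (theta d c \<epsilon> \<gamma>)) A = emeasure (law c) A"
    using A by (simp add: emeasure_distr)
  then have "0 = (\<Sum>\<alpha>'\<in>bits d. \<Sum>\<beta>\<in>perms d. \<epsilon> (\<alpha>', \<beta>) * (\<integral>w. G w * indicator A (\<Psi> \<alpha>' \<beta> w) \<partial>?M))"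
    using emeasure_law_theta_eq_iff[OF A] by simp
  also have "\<dots> = (\<Sum>\<alpha>'\<in>bits d. S \<alpha>' * (\<integral>w. G w * indicator A (tau_act d \<alpha>' w) \<partial>?M))"
    unfolding S_def using symmetric_\<Psi>[OF sym]
    by (intro sum_symmetric Bochner_Integration.integral_cong) simp_all
  also have "\<dots> = (\<Sum>\<alpha>'\<in>bits d. S \<alpha>' * (\<integral>w. (if \<alpha>' = \<alpha> then G w else 0) \<partial>?M))"
    using detect by (intro sum.cong arg_cong2[where f = "(*)"] Bochner_Integration.integral_cong) auto
  also have "\<dots> = (\<Sum>\<alpha>'\<in>bits d. if \<alpha>' = \<alpha> then S \<alpha>' * (\<integral>w. G w \<partial>?M) else 0)"
    by (intro sum.cong) auto
  also have "\<dots> = S \<alpha> * (\<integral>w. G w \<partial>?M)"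
    using \<alpha> by (simp add: sum.delta)
  finally show ?thesis using pos by (simp add: S_def)
qed

section \<open>Laws of subvectors and of single coordinates\<close>

lemma delete_coord_measurable:
  assumes k: "k \<in> {1..d}"
  shows "delete_coord d k \<in> measurable (cube_lborel d) (\<Pi>\<^sub>M i\<in>{1..d - 1}. borel)"
proof (rule measurable_PiM_single')
  fix i assume i: "i \<in> {1..d - 1}"
  then have "i \<in> {1..d}" "i + 1 \<in> {1..d}" by auto
  from this[THEN measurable_cube_component] i
  show "(\<lambda>u. delete_coord d k u i) \<in> borel_measurable (cube_lborel d)"
    by (cases "i < k") (simp_all add: delete_coord_def)
qed (auto simp: delete_coord_def)

text \<open>The bit r affects only coordinate k of \<open>\<Psi>\<close>, which is then deleted. The
  integral is therefore the same for both values of r, and the sum of \<epsilon> over r factors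
  out.\<close>

lemma delete_coord_law_eq:
  assumes k: "k \<in> {1..d}"
    and zero: "\<And>j a b. j \<in> {1..d} \<Longrightarrow> a \<in> bits (d - 1) \<Longrightarrow> b \<in> perms (d - 1) \<Longrightarrow>
      (\<Sum>r\<in>{0, 1}. \<epsilon> (insert_coord d k a r, chi d j b k)) = 0"
  shows "distr (law (theta d c \<epsilon> \<gamma>)) (\<Pi>\<^sub>M i\<in>{1..d - 1}. borel) (delete_coord d k)
    = distr (law c) (\<Pi>\<^sub>M i\<in>{1..d - 1}. borel) (delete_coord d k)"
proof (rule distr_law_theta_eq[OF delete_coord_measurable[OF k]])
  fix B :: "(nat \<Rightarrow> real) set"
  let ?F = "\<lambda>\<alpha> \<beta>. (\<integral>w. G w * indicator B (delete_coord d k (\<Psi> \<alpha> \<beta> w)) \<partial>cube_lborel d)"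
  have indep: "delete_coord d k (\<Psi> (insert_coord d k a r) \<beta> w) = delete_coord d k (\<Psi> (insert_coord d k a 0) \<beta> w)"
    for a \<beta> w and r :: nat
    by (auto simp: fun_eq_iff delete_coord_def tau_act_def insert_coord_def)
  have F: "?F (insert_coord d k a r) \<beta> = ?F (insert_coord d k a 0) \<beta>" for a \<beta> and r :: nat
    by (subst indep) (rule refl)
  have "(\<Sum>\<alpha>\<in>bits d. \<Sum>\<beta>\<in>perms d. \<epsilon> (\<alpha>, \<beta>) * ?F \<alpha> \<beta>)
      = (\<Sum>a\<in>bits (d - 1). \<Sum>r\<in>{0, 1}. \<Sum>j\<in>{1..d}. \<Sum>b\<in>perms (d - 1).
          \<epsilon> (insert_coord d k a r, chi d j b k) * ?F (insert_coord d k a r) (chi d j b k))"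
    by (simp only: sum_bits_insert_coord[OF k] sum_perms_chi[OF k])
  also have "\<dots> = (\<Sum>a\<in>bits (d - 1). \<Sum>r\<in>{0, 1}. \<Sum>j\<in>{1..d}. \<Sum>b\<in>perms (d - 1).
          \<epsilon> (insert_coord d k a r, chi d j b k) * ?F (insert_coord d k a 0) (chi d j b k))"
    by (intro sum.cong refl arg_cong2[where f = "(*)"] F)
  also have "\<dots> = (\<Sum>a\<in>bits (d - 1). \<Sum>j\<in>{1..d}. \<Sum>r\<in>{0, 1}. \<Sum>b\<in>perms (d - 1).
          \<epsilon> (insert_coord d k a r, chi d j b k) * ?F (insert_coord d k a 0) (chi d j b k))"
    by (rule sum.cong[OF refl sum.swap])
  also have "\<dots> = (\<Sum>a\<in>bits (d - 1). \<Sum>j\<in>{1..d}. \<Sum>b\<in>perms (d - 1). \<Sum>r\<in>{0, 1}.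
          \<epsilon> (insert_coord d k a r, chi d j b k) * ?F (insert_coord d k a 0) (chi d j b k))"
    by (rule sum.cong[OF refl sum.cong[OF refl sum.swap]])
  also have "\<dots> = 0"
    unfolding sum_distrib_right[symmetric]
    by (intro sum.neutral ballI) (simp only: zero mult_zero_left)
  finally show "(\<Sum>\<alpha>\<in>bits d. \<Sum>\<beta>\<in>perms d. \<epsilon> (\<alpha>, \<beta>) * ?F \<alpha> \<beta>) = 0" .
qed

text \<open>As \<open>chi d j b k\<close> sends j to k, coordinate k of \<open>\<Psi>\<close> is
  \<open>w j\<close> or \<open>1 - w j\<close> according to r, whatever a and b are. The sum of
  \<epsilon> over a and b factors out; r remains visible, hence one condition for each of its
  values.\<close>

lemma marginal_law_eq:
  assumes k: "k \<in> {1..d}"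
    and zero: "\<And>j r. j \<in> {1..d} \<Longrightarrow> r \<in> {0, 1} \<Longrightarrow>
      (\<Sum>(a, b)\<in>bits (d - 1) \<times> perms (d - 1). \<epsilon> (insert_coord d k a r, chi d j b k)) = 0"
  shows "distr (law (theta d c \<epsilon> \<gamma>)) lborel (\<lambda>u. u k) = distr (law c) lborel (\<lambda>u. u k)"
proof (rule distr_law_theta_eq)
  show "(\<lambda>u. u k) \<in> measurable (cube_lborel d) lborel"
    using measurable_cube_component[OF k] by simp
  fix B :: "real set"
  let ?F = "\<lambda>\<alpha> \<beta>. (\<integral>w. G w * indicator B (\<Psi> \<alpha> \<beta> w k) \<partial>cube_lborel d)"
  let ?L = "\<lambda>r j. (\<integral>w. G w * indicator B (if r = (1::nat) then 1 - w j else w j) \<partial>cube_lborel d)"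
  have F: "?F (insert_coord d k a r) (chi d j b k) = ?L r j"
    if "a \<in> bits (d - 1)" "r \<in> {0, 1}" "j \<in> {1..d}" "b \<in> perms (d - 1)" for a r j b
  proof -
    have "inv (chi d j b k) k = j"
      using perms_inverses(2)[OF chi_perms[OF that(4,3) k], of j] chi_apply[OF that(3)] by simp
    then have "\<Psi> (insert_coord d k a r) (chi d j b k) w k = (if r = 1 then 1 - w j else w j)" for w
      using k by (simp only: tau_act_apply[OF insert_coord_bits[OF that(1,2) k] k])
        (simp only: insert_coord_def sigma_act_def restrict_apply simp_thms if_True less_irrefl if_False)
    then show ?thesis by simp
  qed
  have "(\<Sum>\<alpha>\<in>bits d. \<Sum>\<beta>\<in>perms d. \<epsilon> (\<alpha>, \<beta>) * ?F \<alpha> \<beta>)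
      = (\<Sum>a\<in>bits (d - 1). \<Sum>r\<in>{0, 1}. \<Sum>j\<in>{1..d}. \<Sum>b\<in>perms (d - 1).
          \<epsilon> (insert_coord d k a r, chi d j b k) * ?F (insert_coord d k a r) (chi d j b k))"
    by (simp only: sum_bits_insert_coord[OF k] sum_perms_chi[OF k])
  also have "\<dots> = (\<Sum>a\<in>bits (d - 1). \<Sum>r\<in>{0, 1}. \<Sum>j\<in>{1..d}. \<Sum>b\<in>perms (d - 1).
          \<epsilon> (insert_coord d k a r, chi d j b k) * ?L r j)"
    by (intro sum.cong refl arg_cong2[where f = "(*)"] F)
  also have "\<dots> = (\<Sum>r\<in>{0, 1}. \<Sum>a\<in>bits (d - 1). \<Sum>j\<in>{1..d}. \<Sum>b\<in>perms (d - 1).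
          \<epsilon> (insert_coord d k a r, chi d j b k) * ?L r j)"
    by (rule sum.swap)
  also have "\<dots> = (\<Sum>r\<in>{0, 1}. \<Sum>j\<in>{1..d}. \<Sum>a\<in>bits (d - 1). \<Sum>b\<in>perms (d - 1).
          \<epsilon> (insert_coord d k a r, chi d j b k) * ?L r j)"
    by (rule sum.cong[OF refl sum.swap])
  also have "\<dots> = (\<Sum>r\<in>{0, 1}. \<Sum>j\<in>{1..d}.
      (\<Sum>(a, b)\<in>bits (d - 1) \<times> perms (d - 1). \<epsilon> (insert_coord d k a r, chi d j b k)) * ?L r j)"
    by (simp only: sum_distrib_right sum.cartesian_product split_def)
  also have "\<dots> = 0" using zero by (intro sum.neutral ballI) (simp only: mult_zero_left)
  finally show "(\<Sum>\<alpha>\<in>bits d. \<Sum>\<beta>\<in>perms d. \<epsilon> (\<alpha>, \<beta>) * ?F \<alpha> \<beta>) = 0" .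
qed

end

section \<open>From pushforwards of densities to random vectors\<close>

theorem theorem4:
  fixes d :: nat
    and c \<gamma> :: "(nat \<Rightarrow> real) \<Rightarrow> real"
    and \<epsilon> :: "(nat \<Rightarrow> nat) \<times> (nat \<Rightarrow> nat) \<Rightarrow> real"
  assumes "d \<ge> 2"
    and "prob_density d c"
    and "set_integrable (cube_lborel d) (Delta0 d) \<gamma>"
    and "\<forall>u\<in>Delta0 d. 0 \<le> \<gamma> u"
    and "\<epsilon> \<in> bits d \<times> perms d \<rightarrow> {-1..1}"
    and "\<forall>u\<in>Delta0 d.
           ereal (\<gamma> u) \<le>
           (INF (\<alpha>, \<beta>)\<in>{(\<alpha>, \<beta>). \<alpha> \<in> bits d \<and> \<beta> \<in> perms d \<and> \<epsilon> (\<alpha>, \<beta>) > 0}.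
              ereal (c (tau_act d \<alpha> (sigma_act d (inv \<beta>) u)) / \<epsilon> (\<alpha>, \<beta>)))"
  shows
    "((\<Sum>(\<alpha>, \<beta>)\<in>bits d \<times> perms d. \<epsilon> (\<alpha>, \<beta>)) = 0 \<longrightarrow> prob_density d (theta d c \<epsilon> \<gamma>))
     \<and> (\<not> (AE u in cube_lborel d. u \<in> Delta0 d \<longrightarrow> \<gamma> u = 0) \<longrightarrow>
          (prob_density d (theta d c \<epsilon> \<gamma>) \<longleftrightarrow>
           (\<Sum>(\<alpha>, \<beta>)\<in>bits d \<times> perms d. \<epsilon> (\<alpha>, \<beta>)) = 0))
     \<and> ((\<Sum>(\<alpha>, \<beta>)\<in>bits d \<times> perms d. \<epsilon> (\<alpha>, \<beta>)) = 0 \<longrightarrow>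
          (\<forall>(M :: 'a measure) (N :: 'b measure) U V.
             prob_space M \<and> prob_space N \<and>
             distributed M (cube_lborel d) U (\<lambda>u. ennreal (c u)) \<and>
             distributed N (cube_lborel d) V (\<lambda>u. ennreal (theta d c \<epsilon> \<gamma> u)) \<longrightarrow>
             ((\<forall>\<alpha>\<in>bits d. (\<Sum>\<beta>\<in>perms d. \<epsilon> (sigma_act d (inv \<beta>) \<alpha>, \<beta>)) = 0) \<longrightarrow>
                (\<forall>g :: (nat \<Rightarrow> real) \<Rightarrow> real.
                   g \<in> borel_measurable (cube_lborel d) \<and> symmetric_fun d g \<longrightarrow>
                   distr N borel (\<lambda>x. g (V x)) = distr M borel (\<lambda>x. g (U x))))
             \<and> (\<not> (AE u in cube_lborel d. u \<in> Delta0 d \<longrightarrow> \<gamma> u = 0) \<longrightarrow>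
                ((\<forall>g :: (nat \<Rightarrow> real) \<Rightarrow> real.
                    g \<in> borel_measurable (cube_lborel d) \<and> symmetric_fun d g \<longrightarrow>
                    distr N borel (\<lambda>x. g (V x)) = distr M borel (\<lambda>x. g (U x))) \<longleftrightarrow>
                 (\<forall>\<alpha>\<in>bits d. (\<Sum>\<beta>\<in>perms d. \<epsilon> (sigma_act d (inv \<beta>) \<alpha>, \<beta>)) = 0)))
             \<and> ((\<forall>\<alpha>\<in>bits d. (\<Sum>\<beta>\<in>perms d. \<epsilon> (sigma_act d (inv \<beta>) \<alpha>, \<beta>)) = 0) \<longrightarrow>
                distr N borel (\<lambda>x. \<Sum>i\<in>{1..d}. V x i)
                  = distr M borel (\<lambda>x. \<Sum>i\<in>{1..d}. U x i))
             \<and> (\<forall>k\<in>{1..d}.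
                  (\<forall>j\<in>{1..d}. \<forall>a\<in>bits (d - 1). \<forall>b\<in>perms (d - 1).
                     (\<Sum>r\<in>{0, 1}. \<epsilon> (insert_coord d k a r, chi d j b k)) = 0) \<longrightarrow>
                  distr N (\<Pi>\<^sub>M i\<in>{1..d - 1}. borel) (\<lambda>x. delete_coord d k (V x))
                    = distr M (\<Pi>\<^sub>M i\<in>{1..d - 1}. borel) (\<lambda>x. delete_coord d k (U x))))
          \<and> (copula_density d c \<longrightarrow>
             (\<forall>j\<in>{1..d}. \<forall>k\<in>{1..d}.
                (\<Sum>(a, b)\<in>bits (d - 1) \<times> perms (d - 1).
                   \<epsilon> (insert_coord d k a 0, chi d j b k)) = 0 \<and>
                (\<Sum>(a, b)\<in>bits (d - 1) \<times> perms (d - 1).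
                   \<epsilon> (insert_coord d k a 1, chi d j b k)) = 0) \<longrightarrow>
             copula_density d (theta d c \<epsilon> \<gamma>)))"
proof -
  let ?S = "(\<Sum>(\<alpha>, \<beta>)\<in>bits d \<times> perms d. \<epsilon> (\<alpha>, \<beta>)) = 0"
  let ?null = "AE u in cube_lborel d. u \<in> Delta0 d \<longrightarrow> \<gamma> u = 0"
  let ?zero = "\<forall>\<alpha>\<in>bits d. (\<Sum>\<beta>\<in>perms d. \<epsilon> (sigma_act d (inv \<beta>) \<alpha>, \<beta>)) = 0"
  interpret perturbed_density d c \<gamma> \<epsilon>
  proof
    fix \<alpha> \<beta> u assume *: "\<alpha> \<in> bits d" "\<beta> \<in> perms d" "0 < \<epsilon> (\<alpha>, \<beta>)" "u \<in> Delta0 d"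
    \<comment> \<open>The infimum lies below its member at (\<alpha>, \<beta>); multiplying by the
      positive \<epsilon> then clears the quotient.\<close>
    have "ereal (\<gamma> u) \<le> ereal (c (tau_act d \<alpha> (sigma_act d (inv \<beta>) u)) / \<epsilon> (\<alpha>, \<beta>))"
      by (rule order_trans[OF assms(6)[rule_format, OF *(4)]], rule INF_lower2[of "(\<alpha>, \<beta>)"])
         (use * in auto)
    then show "\<epsilon> (\<alpha>, \<beta>) * \<gamma> u \<le> c (tau_act d \<alpha> (sigma_act d (inv \<beta>) u))"
      using *(3) by (simp add: pos_le_divide_eq mult.commute)
  qed (use assms in auto)
  have D: "?S \<longrightarrow> prob_density d (theta d c \<epsilon> \<gamma>)"
    by (simp add: prob_density_theta_iff)
  have D_iff: "\<not> ?null \<longrightarrow> (prob_density d (theta d c \<epsilon> \<gamma>) \<longleftrightarrow> ?S)"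
    using integral_G_pos by (auto simp: prob_density_theta_iff)
  \<comment> \<open>U and V matter only through their laws, so every claim about them is one about
    pushforwards of the two densities, whatever the underlying probability spaces.\<close>
  have laws: "distr N L (\<lambda>x. h (V x)) = distr M L (\<lambda>x. h (U x)) \<longleftrightarrow>
      distr (law (theta d c \<epsilon> \<gamma>)) L h = distr (law c) L h"
    if U: "distributed M (cube_lborel d) U (\<lambda>u. ennreal (c u))"
      and V: "distributed N (cube_lborel d) V (\<lambda>u. ennreal (theta d c \<epsilon> \<gamma> u))"
      and h: "h \<in> measurable (cube_lborel d) L"
    for M :: "'a measure" and N :: "'b measure" and U V and L :: "'z measure" and h
  proof -
    have "distr M L (\<lambda>x. h (U x)) = distr (law c) L h"
      using distr_distr[OF h distributed_measurable[OF U]] distributed_distr_eq_density[OF U]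
      by (simp add: comp_def)
    moreover have "distr N L (\<lambda>x. h (V x)) = distr (law (theta d c \<epsilon> \<gamma>)) L h"
      using distr_distr[OF h distributed_measurable[OF V]] distributed_distr_eq_density[OF V]
      by (simp add: comp_def)
    ultimately show ?thesis by simp
  qed
  have sum_measurable: "(\<lambda>u. \<Sum>i\<in>{1..d}. u i) \<in> borel_measurable (cube_lborel d)"
    by (intro borel_measurable_sum measurable_cube_component)
  have sum_symm: "symmetric_fun d (\<lambda>u. \<Sum>i\<in>{1..d}. u i :: real)"
    unfolding symmetric_fun_def
  proof (intro ballI)
    fix \<beta> and u :: "nat \<Rightarrow> real" assume \<beta>: "\<beta> \<in> perms d"
    have "(\<Sum>i\<in>{1..d}. sigma_act d \<beta> u i) = (\<Sum>i\<in>{1..d}. u (\<beta> i))"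
      by (simp add: sigma_act_def)
    also have "\<dots> = (\<Sum>i\<in>{1..d}. u i)"
      using sum.permute[of \<beta> "{1..d}" u] \<beta> by (simp add: perms_def comp_def)
    finally show "(\<Sum>i\<in>{1..d}. sigma_act d \<beta> u i) = (\<Sum>i\<in>{1..d}. u i)" .
  qed
  have G_imp: "distr N borel (\<lambda>x. g (V x)) = distr M borel (\<lambda>x. g (U x))"
    if "distributed M (cube_lborel d) U (\<lambda>u. ennreal (c u))"
      and "distributed N (cube_lborel d) V (\<lambda>u. ennreal (theta d c \<epsilon> \<gamma> u))"
      and "?zero" "g \<in> borel_measurable (cube_lborel d)" "symmetric_fun d g"
    for M :: "'a measure" and N :: "'b measure" and U V and g :: "(nat \<Rightarrow> real) \<Rightarrow> real"
    using laws[OF that(1,2,4)] symmetric_law_eq[OF that(3-5)] by blast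
  have G_rev: "?zero"
    if "distributed M (cube_lborel d) U (\<lambda>u. ennreal (c u))"
      and "distributed N (cube_lborel d) V (\<lambda>u. ennreal (theta d c \<epsilon> \<gamma> u))"
      and "\<not> ?null"
      and eq: "\<forall>g :: (nat \<Rightarrow> real) \<Rightarrow> real. g \<in> borel_measurable (cube_lborel d) \<and> symmetric_fun d g \<longrightarrow>
        distr N borel (\<lambda>x. g (V x)) = distr M borel (\<lambda>x. g (U x))"
    for M :: "'a measure" and N :: "'b measure" and U V
    using symmetric_law_eq_imp_zero[OF _ integral_G_pos[OF that(3)]] laws[OF that(1,2)] eq by blast
  have M_imp: "distr N (\<Pi>\<^sub>M i\<in>{1..d - 1}. borel) (\<lambda>x. delete_coord d k (V x))
      = distr M (\<Pi>\<^sub>M i\<in>{1..d - 1}. borel) (\<lambda>x. delete_coord d k (U x))"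
    if "distributed M (cube_lborel d) U (\<lambda>u. ennreal (c u))"
      and "distributed N (cube_lborel d) V (\<lambda>u. ennreal (theta d c \<epsilon> \<gamma> u))"
      and k: "k \<in> {1..d}"
      and zero: "\<forall>j\<in>{1..d}. \<forall>a\<in>bits (d - 1). \<forall>b\<in>perms (d - 1).
        (\<Sum>r\<in>{0, 1}. \<epsilon> (insert_coord d k a r, chi d j b k)) = 0"
    for M :: "'a measure" and N :: "'b measure" and U V k
    using laws[OF that(1,2) delete_coord_measurable[OF k]]
      delete_coord_law_eq[OF k zero[rule_format]] by blast
  have C: "copula_density d (theta d c \<epsilon> \<gamma>)"
    if S: ?S and c: "copula_density d c"
      and zero: "\<forall>j\<in>{1..d}. \<forall>k\<in>{1..d}.
        (\<Sum>(a, b)\<in>bits (d - 1) \<times> perms (d - 1). \<epsilon> (insert_coord d k a 0, chi d j b k)) = 0 \<and>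
        (\<Sum>(a, b)\<in>bits (d - 1) \<times> perms (d - 1). \<epsilon> (insert_coord d k a 1, chi d j b k)) = 0"
    unfolding copula_density_def
  proof (intro conjI ballI)
    show "prob_density d (theta d c \<epsilon> \<gamma>)" using D S by blast
    fix k assume k: "k \<in> {1..d}"
    have "distr (law (theta d c \<epsilon> \<gamma>)) lborel (\<lambda>u. u k) = distr (law c) lborel (\<lambda>u. u k)"
    proof (rule marginal_law_eq[OF k])
      fix j and r :: nat assume "j \<in> {1..d}" "r \<in> {0, 1}"
      then show "(\<Sum>(a, b)\<in>bits (d - 1) \<times> perms (d - 1). \<epsilon> (insert_coord d k a r, chi d j b k)) = 0"
        using zero k by blast
    qed
    also have "\<dots> = uniform_measure lborel {0..1}"
      using c k unfolding copula_density_def by blast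
    finally show "distr (law (theta d c \<epsilon> \<gamma>)) lborel (\<lambda>u. u k) = uniform_measure lborel {0..1}" .
  qed
  show ?thesis
  proof (intro conjI impI allI ballI, goal_cases)
    case 1 then show ?case using D by blast
  next
    case 2 then show ?case using D_iff by blast
  next
    case (3 M N U V g) then show ?case using G_imp by blast
  next
    case (4 M N U V)
    then have UV: "distributed M (cube_lborel d) U (\<lambda>u. ennreal (c u))"
      "distributed N (cube_lborel d) V (\<lambda>u. ennreal (theta d c \<epsilon> \<gamma> u))" by blast+
    show ?case
    proof (intro iffI)
      assume "\<forall>g :: (nat \<Rightarrow> real) \<Rightarrow> real. g \<in> borel_measurable (cube_lborel d) \<and> symmetric_fun d g \<longrightarrow>
        distr N borel (\<lambda>x. g (V x)) = distr M borel (\<lambda>x. g (U x))"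
      then show ?zero by (rule G_rev[OF UV 4(3)])
    next
      assume zero: ?zero
      show "\<forall>g :: (nat \<Rightarrow> real) \<Rightarrow> real. g \<in> borel_measurable (cube_lborel d) \<and> symmetric_fun d g \<longrightarrow>
        distr N borel (\<lambda>x. g (V x)) = distr M borel (\<lambda>x. g (U x))"
        using G_imp[OF UV zero] by blast
    qed
  next
    case (5 M N U V)
    then show ?case
      using G_imp[of M U N V, OF _ _ _ sum_measurable sum_symm] by blast
  next
    case (6 M N U V k) then show ?case using M_imp by blast
  next
    case 7 then show ?case using C by blast
  qed
qed

end
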